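(* Let $d\ge2$. The problem $\operatorname{PM}^d_\boxtimes$ can be solved with a uniform local algorithm of uniform complexity $\sqrt[d-1]{1/\varepsilon}\cdot 2^{O(\sqrt{\log 1/\varepsilon})}$.
   Context: $\mathbb{Z}^d$ denotes the infinite grid: the Cayley graph of the group $\mathbb{Z}^d$ with respect to the standard generators, each edge being oriented and labelled by its generator (isomorphisms preserve this structure). $\mathbb{Z}^d_\boxtimes$ is the graph on the same vertex set in which two different vertices $u=(u_1,\dots,u_d)$ and $v=(v_1,\dots,v_d)$ are connected by an edge if $\sum_{1\le i\le d}|u_i-v_i|\le 2$. $\operatorname{PM}^d_\boxtimes$ is the problem of finding a perfect matching of the graph $\mathbb{Z}^d_\boxtimes$ (each vertex outputs, e.g., the difference vector to its partner), viewed as a local problem on $\mathbb{Z}^d$. A uniform local algorithm (for a problem without inputs, with finite output label set $\Sigma_{out}$) is a pair $\mathcal A=(\mathcal C,f)$, where $\mathcal C$ is a collection of rooted finite-radius neighborhoods in $\mathbb{Z}^d$ with vertices labelled by reals in $[0,1]$, and $f:\mathcal C\to\Sigma_{out}$ is measurable. It is run on $\mathbb{Z}^d$ whose vertices carry independent uniform labels from $[0,1]$: each vertex explores balls of radius $0,1,2,\dots$ around itself until the labelled ball lies in $\mathcal C$, and then outputs the value of $f$. It solves a problem if with probability $1$ every vertex outputs a label and the resulting labelling is a valid solution. The coding radius $R_{\mathcal A}$ is the (random) minimal radius a vertex needs to explore. $\mathcal A$ has uniform complexity $t(\varepsilon)$ if $\mathrm P(R_{\mathcal A}>t(\varepsilon))\le\varepsilon$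 for all sufficiently small $\varepsilon>0$. *)

theory Defs
  imports "HOL-Probability.Probability" "HOL-Library.Landau_Symbols"
begin

text \<open>
  The dimension d is the cardinality of the finite index type \<open>'d\<close>; the vertices of the grid are
  the elements of \<open>int ^ 'd\<close>.
\<close>

type_synonym 'd vertex = "int ^ 'd"

definition grid_edges :: "('d::finite vertex \<times> 'd \<times> 'd vertex) set" where
  "grid_edges = {(u, i, u + axis i 1) | u i. True}"

definition grid_adj :: "'d::finite vertex rel" where
  "grid_adj = {(u, v). \<exists>i. (u, i, v) \<in> grid_edges \<or> (v, i, u) \<in> grid_edges}"

definition grid_ball :: "nat \<Rightarrow> 'd::finite vertex set" where
  "grid_ball r = {v. \<exists>k\<le>r. (0, v) \<in> grid_adj ^^ k}"

definition boxtimes_adj :: "'d::finite vertex \<Rightarrow> 'd vertex \<Rightarrow> bool" where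
  "boxtimes_adj u v \<longleftrightarrow> u \<noteq> v \<and> (\<Sum>i\<in>UNIV. \<bar>u $ i - v $ i\<bar>) \<le> 2"

definition unif01 :: "real measure" where
  "unif01 = restrict_space lborel {0..1}"

text \<open>
  The only isomorphisms between balls of the grid that preserve roots, orientations and generators
  of edges are translations. An isomorphism class of labelled rooted neighbourhoods of radius \<open>r\<close>
  is therefore given by \<open>r\<close> together with a \<open>[0,1]\<close>-valued labelling of the ball of radius \<open>r\<close>
  around the origin (extended by \<^const>\<open>undefined\<close> outside the ball, as usual for \<^const>\<open>PiM\<close>).
\<close>

type_synonym 'd nbhd = "nat \<times> ('d vertex \<Rightarrow> real)"

definition nbhd_space :: "nat \<Rightarrow> ('d::finite vertex \<Rightarrow> real) measure" where
  "nbhd_space r = PiM (grid_ball r) (\<lambda>_. unif01)"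

definition label_space :: "('d::finite vertex \<Rightarrow> real) measure" where
  "label_space = PiM UNIV (\<lambda>_. unif01)"

definition view :: "('d::finite vertex \<Rightarrow> real) \<Rightarrow> 'd vertex \<Rightarrow> nat \<Rightarrow> 'd nbhd" where
  "view \<omega> u r = (r, \<lambda>v\<in>grid_ball r. \<omega> (u + v))"

text \<open>
  Measurability refers to the disjoint union over all \<open>r\<close> of the spaces of labelled
  neighbourhoods of radius \<open>r\<close>. The collection \<open>C\<close> itself has to be measurable for the coding
  radius to be a random variable; the first condition also says that it consists of
  \<open>[0,1]\<close>-labelled neighbourhoods.
\<close>

definition uniform_local_algorithm ::
  "'o set \<Rightarrow> 'd::finite nbhd set \<Rightarrow> ('d nbhd \<Rightarrow> 'o) \<Rightarrow> bool" where
  "uniform_local_algorithm \<Sigma> C f \<longleftrightarrow>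
     finite \<Sigma> \<and>
     (\<forall>r. {x. (r, x) \<in> C} \<in> sets (nbhd_space r)) \<and>
     (\<forall>r. (\<lambda>x. f (r, x)) \<in> restrict_space (nbhd_space r) {x. (r, x) \<in> C} \<rightarrow>\<^sub>M count_space \<Sigma>)"

text \<open>The value is \<open>\<infinity>\<close> if the exploration never stops.\<close>

definition coding_radius ::
  "'d::finite nbhd set \<Rightarrow> ('d vertex \<Rightarrow> real) \<Rightarrow> 'd vertex \<Rightarrow> enat" where
  "coding_radius C \<omega> u = Inf {enat r | r. view \<omega> u r \<in> C}"

definition run ::
  "'d::finite nbhd set \<Rightarrow> ('d nbhd \<Rightarrow> 'o) \<Rightarrow> ('d vertex \<Rightarrow> real) \<Rightarrow> 'd vertex \<Rightarrow> 'o" where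
  "run C f \<omega> u = f (view \<omega> u (the_enat (coding_radius C \<omega> u)))"

definition solves ::
  "'d::finite nbhd set \<Rightarrow> ('d nbhd \<Rightarrow> 'o) \<Rightarrow> (('d vertex \<Rightarrow> 'o) \<Rightarrow> bool) \<Rightarrow> bool" where
  "solves C f valid \<longleftrightarrow>
     (AE \<omega> in label_space. (\<forall>u. coding_radius C \<omega> u \<noteq> \<infinity>) \<and> valid (run C f \<omega>))"

text \<open>
  The distribution of the coding radius does not depend on the vertex \<open>u\<close>.
\<close>

definition has_uniform_complexity :: "'d::finite nbhd set \<Rightarrow> (real \<Rightarrow> real) \<Rightarrow> bool" where
  "has_uniform_complexity C t \<longleftrightarrow>
     (\<forall>\<^sub>F \<epsilon> in at_right 0. \<forall>u.
        measure label_space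
          {\<omega> \<in> space label_space. ereal_of_enat (coding_radius C \<omega> u) > ereal (t \<epsilon>)} \<le> \<epsilon>)"

definition boxtimes_perfect_matching :: "'d::finite vertex set set \<Rightarrow> bool" where
  "boxtimes_perfect_matching M \<longleftrightarrow>
     M \<subseteq> {{u, v} | u v. boxtimes_adj u v} \<and> (\<forall>u. \<exists>!e. e \<in> M \<and> u \<in> e)"

text \<open>Every vertex outputs the difference vector to its partner.\<close>

definition PM_labels :: "'d::finite vertex set" where
  "PM_labels = {w. boxtimes_adj 0 w}"

definition PM_valid :: "('d::finite vertex \<Rightarrow> 'd vertex) \<Rightarrow> bool" where
  "PM_valid x \<longleftrightarrow> (\<exists>M. boxtimes_perfect_matching M \<and> (\<forall>u. {u, u + x u} \<in> M))"

text \<open>This is a local problem: validity can be checked in neighbourhoods of radius 2.\<close>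

lemma boxtimes_adj_diff: "boxtimes_adj u (u + w) \<longleftrightarrow> w \<in> PM_labels"
  by (auto simp: boxtimes_adj_def PM_labels_def)

lemma boxtimes_adj_sym: "boxtimes_adj u v \<longleftrightarrow> boxtimes_adj v u"
  by (auto simp: boxtimes_adj_def abs_minus_commute)

lemma PM_valid_iff_local:
  "PM_valid x \<longleftrightarrow> (\<forall>u. x u \<in> PM_labels \<and> x (u + x u) = - x u)"
proof
  assume "PM_valid x"
  then obtain M where M: "M \<subseteq> {{u, v} | u v. boxtimes_adj u v}"
      "\<And>u. \<exists>!e. e \<in> M \<and> u \<in> e" and x: "\<And>u. {u, u + x u} \<in> M"
    unfolding PM_valid_def boxtimes_perfect_matching_def by blast
  show "\<forall>u. x u \<in> PM_labels \<and> x (u + x u) = - x u"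
  proof (intro allI conjI)
    fix u
    obtain a b where ab: "{u, u + x u} = {a, b}" "boxtimes_adj a b"
      using M(1) x[of u] by blast
    then have "boxtimes_adj u (u + x u)"
      by (metis boxtimes_adj_sym doubleton_eq_iff)
    then show lab: "x u \<in> PM_labels" by (simp add: boxtimes_adj_diff)
    have "{u, u + x u} = {u + x u, u + x u + x (u + x u)}"
      using M(2)[of "u + x u"] x[of u] x[of "u + x u"] by blast
    moreover have "x u \<noteq> 0"
      using lab by (auto simp: PM_labels_def boxtimes_adj_def)
    ultimately have "u = u + x u + x (u + x u)"
      by (auto simp: doubleton_eq_iff)
    then show "x (u + x u) = - x u"
      by (metis add.assoc add_cancel_right_right add_eq_0_iff)
  qed
next
  assume *: "\<forall>u. x u \<in> PM_labels \<and> x (u + x u) = - x u"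
  let ?M = "range (\<lambda>u. {u, u + x u})"
  have "boxtimes_perfect_matching ?M"
    unfolding boxtimes_perfect_matching_def
  proof (intro conjI allI)
    show "?M \<subseteq> {{u, v} | u v. boxtimes_adj u v}"
      using * boxtimes_adj_diff by blast
    fix u
    show "\<exists>!e. e \<in> ?M \<and> u \<in> e"
    proof (rule ex1I[of _ "{u, u + x u}"])
      fix e assume "e \<in> ?M \<and> u \<in> e"
      then obtain v where v: "e = {v, v + x v}" "u = v \<or> u = v + x v" by auto
      then show "e = {u, u + x u}" using * by (auto simp: insert_commute)
    qed auto
  qed
  then show "PM_valid x" unfolding PM_valid_def by blast
qed

end

theory Submission
  imports Defs "HOL-Real_Asymp.Real_Asymp"
begin

text \<open>
  Every vertex chooses a neighbour as its parent, so that no vertex has infinitely many descendants.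
  The square of such a forest is matched from the leaves upwards: each vertex pairs off those of its
  children that are left over, and takes the last one itself if their number is odd. A vertex can
  hence compute its partner from the descendants of its parent, and the task is to make the
  probability that these reach distance \<open>r\<close> as small as \<open>r powr -(d - 1)\<close>, up to lower order factors.

  To this end, let \<open>c\<^sub>k = 2 ^ k\<^sup>2\<close> and let the centers of level \<open>k\<close> be a Bernoulli set of density
  \<open>(2 ^ k / c\<^sub>k) ^ d\<close>, together with all vertices that have no Bernoulli point within distance \<open>c\<^sub>k\<close>;
  the latter are so rare that they do not affect the density, and thanks to them the centers are
  always \<open>c\<^sub>k\<close>-dense. The net \<open>T\<^sub>0\<close> is the whole grid, and \<open>T\<^sub>k\<close> consists of walks in \<open>T\<^sub>k\<^sub>-\<^sub>1\<close> joining all pairs of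
  level \<open>k\<close> centers at distance at most \<open>3 c\<^sub>k\<close>. Inductively, vertices at distance \<open>n \<ge> c\<^sub>k\<close> are joined
  by walks of length \<open>O(3 ^ k n)\<close> in \<open>T\<^sub>k\<close>, because each level stretches distances by the factor 3. So
  \<open>T\<^sub>k\<close> is determined within distance \<open>2 ^ O(k) c\<^sub>k\<close>, it is reached from \<open>T\<^sub>k\<^sub>-\<^sub>1\<close> in as many steps, and
  by a first moment computation its density is at most \<open>2 ^ O(k) c\<^sub>k powr -(d - 1)\<close>. Parents
  lead from \<open>T\<^sub>k\<^sub>-\<^sub>1\<close> to \<open>T\<^sub>k\<close>, and a vertex that is not next to \<open>T\<^sub>k\<close> need not look further than
  \<open>2 ^ O(k) c\<^sub>k\<^sub>+\<^sub>1\<close>. The loss \<open>2 ^ O(k)\<close> is \<open>2 ^ O(sqrt (log c\<^sub>k))\<close>.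
\<close>

section \<open>The grid norm, and walks inside a set of vertices\<close>

definition nrm :: "'d::finite vertex \<Rightarrow> nat" where
  "nrm v = nat (\<Sum>i\<in>UNIV. \<bar>v $ i\<bar>)"

lemma int_nrm: "int (nrm v) = (\<Sum>i\<in>UNIV. \<bar>v $ i\<bar>)"
  by (simp add: nrm_def sum_nonneg)

lemma nrm_0 [simp]: "nrm 0 = 0"
  by (simp add: nrm_def)

lemma nrm_eq_0_iff [simp]: "nrm v = 0 \<longleftrightarrow> v = 0"
proof -
  have "nrm v = 0 \<longleftrightarrow> (\<Sum>i\<in>UNIV. \<bar>v $ i\<bar>) = 0" by (metis int_nrm of_nat_eq_0_iff)
  also have "\<dots> \<longleftrightarrow> v = 0" by (simp add: sum_nonneg_eq_0_iff vec_eq_iff)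
  finally show ?thesis .
qed

lemma nrm_minus [simp]: "nrm (- v) = nrm v"
  by (simp add: nrm_def)

lemma nrm_minus_commute: "nrm (u - v) = nrm (v - u)"
  by (metis minus_diff_eq nrm_minus)

lemma nrm_triangle: "nrm (u + v) \<le> nrm u + nrm v"
proof -
  have "int (nrm (u + v)) \<le> int (nrm u) + int (nrm v)"
    unfolding int_nrm by (simp add: sum.distrib[symmetric] sum_mono abs_triangle_ineq)
  then show ?thesis by linarith
qed

lemma nrm_triangle_diff: "nrm (u - w) \<le> nrm (u - v) + nrm (v - w)"
  using nrm_triangle[of "u - v" "v - w"] by simp

lemma nrm_le_add_diff: "nrm u \<le> nrm v + nrm (u - v)"
  using nrm_triangle[of v "u - v"] by simp

lemma nrm_axis [simp]: "nrm (axis i x) = nat \<bar>x\<bar>"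
proof -
  have "(\<Sum>j\<in>UNIV. \<bar>axis i x $ j\<bar>) = (\<Sum>j\<in>UNIV. if j = i then \<bar>x\<bar> else 0)"
    by (rule sum.cong) (auto simp: axis_def)
  then show ?thesis by (simp add: nrm_def)
qed

lemma grid_adj_nrm: "(u, v) \<in> grid_adj \<Longrightarrow> nrm (v - u) = 1"
proof -
  assume "(u, v) \<in> grid_adj"
  then have "\<exists>i. v - u = axis i 1 \<or> u - v = axis i 1"
    by (force simp: grid_adj_def grid_edges_def)
  then show ?thesis using nrm_minus_commute[of v u] by auto
qed

lemma nrm_SucE:
  assumes "nrm v = Suc n"
  obtains w where "nrm w = n" "(w, v) \<in> grid_adj"
proof -
  from assms have "v \<noteq> 0" by auto
  then obtain i where i: "v $ i \<noteq> 0" by (auto simp: vec_eq_iff)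
  define w where "w = v - axis i (sgn (v $ i))"
  have "int (nrm v) = \<bar>v $ i\<bar> + (\<Sum>j\<in>UNIV - {i}. \<bar>v $ j\<bar>)"
    by (simp add: int_nrm sum.remove[of UNIV i])
  moreover have "int (nrm w) = \<bar>w $ i\<bar> + (\<Sum>j\<in>UNIV - {i}. \<bar>w $ j\<bar>)"
    by (simp add: int_nrm sum.remove[of UNIV i])
  moreover have "(\<Sum>j\<in>UNIV - {i}. \<bar>w $ j\<bar>) = (\<Sum>j\<in>UNIV - {i}. \<bar>v $ j\<bar>)"
    by (rule sum.cong) (auto simp: w_def axis_def)
  moreover have "\<bar>w $ i\<bar> = \<bar>v $ i\<bar> - 1"
    using i by (auto simp: w_def axis_def sgn_if)
  ultimately have "nrm w = n" using assms by linarith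
  moreover have "(w, v) \<in> grid_adj"
  proof (cases "v $ i > 0")
    case True
    then have "v = w + axis i 1" by (simp add: w_def)
    then show ?thesis by (auto simp: grid_adj_def grid_edges_def)
  next
    case False
    have "w + axis i (-1) = v" using i False by (simp add: w_def sgn_if)
    moreover have "axis i (-1) = - (axis i 1 :: int ^ 'a)" by (simp add: vec_eq_iff axis_def)
    ultimately have "w = v + axis i 1" by (simp add: algebra_simps)
    then show ?thesis by (auto simp: grid_adj_def grid_edges_def)
  qed
  ultimately show ?thesis by (rule that)
qed

lemma grid_ball_eq: "grid_ball r = {v :: 'd::finite vertex. nrm v \<le> r}"
proof -
  have "nrm v \<le> k" if "(0, v) \<in> grid_adj ^^ k" for v :: "'d vertex" and k
    using that
  proof (induction k arbitrary: v)
    case (Suc k)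
    then obtain w where w: "(0, w) \<in> grid_adj ^^ k" "(w, v) \<in> grid_adj" by auto
    show ?case using Suc.IH[OF w(1)] grid_adj_nrm[OF w(2)] nrm_le_add_diff[of v w] by linarith
  qed auto
  moreover have "(0, v) \<in> grid_adj ^^ k" if "nrm v = k" for v :: "'d vertex" and k
    using that
  proof (induction k arbitrary: v)
    case (Suc k)
    then show ?case by (metis nrm_SucE relpow_Suc_I)
  qed auto
  ultimately show ?thesis by (fastforce simp: grid_ball_def intro: order_trans)
qed

text \<open>Picks a vertex on a shortest path from the origin to \<open>v\<close>. It cuts long
  distances into hops of prescribed length in \<open>reach_UNIV\<close> and
  \<open>reach_chain\<close>.\<close>

lemma nrm_split:
  assumes "nrm v \<le> a + b"
  obtains w where "nrm w \<le> a" "nrm (v - w) \<le> b"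
  using assms
proof (induction b arbitrary: thesis)
  case 0
  show ?case by (rule "0.prems"(1)[of v]) (use 0 in auto)
next
  case (Suc b)
  show ?case
  proof (cases "nrm v \<le> a + b")
    case True
    then show ?thesis using Suc.IH Suc.prems(1) by (metis le_SucI)
  next
    case False
    then have v: "nrm v = Suc (a + b)" using Suc.prems by simp
    have "\<exists>w. nrm w \<le> a \<and> nrm (v - w) \<le> Suc b" if "nrm v = a + Suc b" for v :: "'a vertex"
      using that
    proof (induction "Suc b" arbitrary: b v)
      case (Suc b)
      obtain u where u: "nrm u = a + b" "(u, v) \<in> grid_adj"
        using nrm_SucE[of v "a + b"] Suc.prems by auto
      have "\<exists>w. nrm w \<le> a \<and> nrm (u - w) \<le> b"
      proof (cases b)
        case 0
        then show ?thesis using u by (intro exI[of _ u]) auto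
      next
        case (Suc b')
        then show ?thesis using Suc.hyps(1)[of b' u] u by auto
      qed
      then obtain w where "nrm w \<le> a" "nrm (u - w) \<le> b" by blast
      then show ?case
        using nrm_triangle_diff[of v w u] grid_adj_nrm[OF u(2)] by (intro exI[of _ w]) linarith
    qed
    then show ?thesis using v Suc.prems(1) by auto
  qed
qed

section \<open>Counting vertices in cubes and balls\<close>

lemma finite_cube: "finite I \<Longrightarrow> finite {v :: int ^ 'd::finite. \<forall>i. v $ i \<in> I}"
  and card_cube: "card {v :: int ^ 'd::finite. \<forall>i. v $ i \<in> I} = card I ^ CARD('d)"
proof -
  have bij: "bij_betw vec_nth {v :: int ^ 'd::finite. \<forall>i. v $ i \<in> I} (UNIV \<rightarrow>\<^sub>E I)"
    by (rule bij_betw_byWitness[where f' = vec_lambda]) auto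
  show "card {v :: int ^ 'd::finite. \<forall>i. v $ i \<in> I} = card I ^ CARD('d)"
    by (simp add: bij_betw_same_card[OF bij] card_PiE)
  show "finite {v :: int ^ 'd::finite. \<forall>i. v $ i \<in> I}" if "finite I"
    using bij_betw_finite[OF bij] that by (simp add: finite_PiE)
qed

lemma abs_nth_le_nrm: "\<bar>v $ i\<bar> \<le> int (nrm v)"
  unfolding int_nrm by (rule member_le_sum) auto

lemma ball_subset_cube: "{v. nrm v \<le> r} \<subseteq> {v. \<forall>i. v $ i \<in> {- int r..int r}}"
proof (rule, clarify)
  fix v :: "'a vertex" and i assume "nrm v \<le> r"
  then have "\<bar>v $ i\<bar> \<le> int r" using abs_nth_le_nrm[of v i] by linarith
  then show "v $ i \<in> {- int r..int r}" by (simp add: abs_le_iff minus_le_iff)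
qed

lemma finite_ball [simp]: "finite {v. nrm v \<le> r}"
  by (rule finite_subset[OF ball_subset_cube finite_cube]) auto

lemma finite_ball_around [simp]: "finite {v. nrm (v - u) \<le> r}"
proof -
  have "{v. nrm (v - u) \<le> r} = (\<lambda>v. v + u) ` {v. nrm v \<le> r}"
    by (auto intro!: image_eqI[of _ _ "_ - u"])
  then show ?thesis by simp
qed

lemma card_ball_le: "card {v :: 'd::finite vertex. nrm v \<le> r} \<le> (2 * r + 1) ^ CARD('d)"
proof -
  have "nat (int r - - int r + 1) = 2 * r + 1" by simp
  then show ?thesis
    using card_mono[OF finite_cube ball_subset_cube[where 'a = 'd]]
    unfolding card_cube by (metis card_atLeastAtMost_int finite_atLeastAtMost_int)
qed

text \<open>The cube of vertices whose coordinates lie between 0 and \<open>r div CARD('d)\<close>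
  is contained in the ball.\<close>

lemma card_ball_ge: "(r div CARD('d) + 1) ^ CARD('d) \<le> card {v :: 'd::finite vertex. nrm v \<le> r}"
proof -
  let ?I = "{0..int (r div CARD('d))}"
  have "{v :: 'd vertex. \<forall>i. v $ i \<in> ?I} \<subseteq> {v. nrm v \<le> r}"
  proof (rule, clarify)
    fix v :: "'d vertex" assume v: "\<forall>i. v $ i \<in> ?I"
    have "int (nrm v) \<le> (\<Sum>i\<in>(UNIV :: 'd set). int (r div CARD('d)))"
      unfolding int_nrm using v by (intro sum_mono) (simp add: abs_of_nonneg)
    also have "\<dots> = int (CARD('d) * (r div CARD('d)))" by simp
    also have "\<dots> \<le> int r" by (simp only: of_nat_le_iff times_div_less_eq_dividend)
    finally show "nrm v \<le> r" by simp
  qed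
  from card_mono[OF finite_ball this] show ?thesis
    unfolding card_cube by (simp add: nat_add_distrib)
qed

text \<open>Steps of norm 0 are allowed, so \<open>n\<close> is only an upper bound for the length
  of the walk and \<open>reach\<close> is monotone in \<open>n\<close>.\<close>

primrec reach :: "('d::finite vertex \<Rightarrow> bool) \<Rightarrow> nat \<Rightarrow> 'd vertex \<Rightarrow> 'd vertex \<Rightarrow> bool" where
  "reach S 0 u v \<longleftrightarrow> S u \<and> u = v"
| "reach S (Suc n) u v \<longleftrightarrow> S u \<and> (\<exists>w. nrm (w - u) \<le> 1 \<and> reach S n w v)"

lemma reach_source: "reach S n u v \<Longrightarrow> S u"
  by (cases n) auto

lemma reach_target: "reach S n u v \<Longrightarrow> S v"
  by (induction n arbitrary: u) auto

lemma reach_refl: "S u \<Longrightarrow> reach S n u u"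
  by (induction n) (auto intro!: exI[of _ u])

lemma reach_trans: "reach S m u v \<Longrightarrow> reach S n v w \<Longrightarrow> reach S (m + n) u w"
  by (induction m arbitrary: u) auto

lemma reach_mono_set: "reach S n u v \<Longrightarrow> (\<And>x. S x \<Longrightarrow> T x) \<Longrightarrow> reach T n u v"
  by (induction n arbitrary: u) auto

lemma reach_mono: "reach S m u v \<Longrightarrow> m \<le> n \<Longrightarrow> reach S n u v"
  using reach_trans[of S m u v "n - m" v] reach_refl[of S v] reach_target[of S m u v] by auto

lemma reach_sym: "reach S n u v \<Longrightarrow> reach S n v u"
proof (induction n arbitrary: u)
  case (Suc n)
  then obtain w where w: "S u" "nrm (w - u) \<le> 1" "reach S n w v" by auto
  have "reach S 1 w u"
    using w reach_source[OF w(3)] by (auto simp: nrm_minus_commute)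
  from reach_trans[OF Suc.IH[OF w(3)] this] show ?case by simp
qed auto

lemma reach_nrm: "reach S n u v \<Longrightarrow> nrm (v - u) \<le> n"
proof (induction n arbitrary: u)
  case (Suc n)
  then obtain w where w: "nrm (w - u) \<le> 1" "reach S n w v" by auto
  show ?case using Suc.IH[OF w(2)] w(1) nrm_triangle_diff[of v u w] by linarith
qed auto

lemma reach_UNIV: "nrm (v - u) \<le> n \<Longrightarrow> reach (\<lambda>_. True) n u v"
proof (induction n arbitrary: u)
  case (Suc n)
  then obtain w where "nrm w \<le> 1" "nrm ((v - u) - w) \<le> n"
    using nrm_split[of "v - u" 1 n] by auto
  then show ?case
    using Suc.IH[of "u + w"] by (auto simp: algebra_simps intro!: exI[of _ "u + w"])
qed auto

text \<open>A walk of \<open>n\<close> steps sees the set only within distance \<open>n\<close> of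
  its start. Comparing with a translate treats locality and translation invariance at once.\<close>

lemma reach_shift:
  assumes "\<And>x. nrm (x - u) \<le> n \<Longrightarrow> S' x = S (a + x)"
  shows "reach S' n u v \<longleftrightarrow> reach S n (a + u) (a + v)"
  using assms
proof (induction n arbitrary: u)
  case 0
  from 0[of u] show ?case by auto
next
  case (Suc n)
  have *: "reach S' n w v = reach S n (a + w) (a + v)" if "nrm (w - u) \<le> 1" for w
  proof (rule Suc.IH)
    fix x assume "nrm (x - w) \<le> n"
    then have "nrm (x - u) \<le> Suc n" using that nrm_triangle_diff[of x u w] by linarith
    then show "S' x = S (a + x)" by (rule Suc.prems)
  qed
  have "(\<exists>w. nrm (w - u) \<le> 1 \<and> reach S' n w v) \<longleftrightarrow>
      (\<exists>w. nrm (w - (a + u)) \<le> 1 \<and> reach S n w (a + v))" (is "?L = ?R")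
  proof
    assume ?L
    then obtain w where "nrm (w - u) \<le> 1" "reach S' n w v" by blast
    then show ?R using * by (intro exI[of _ "a + w"]) auto
  next
    assume ?R
    then obtain w where w: "nrm (w - (a + u)) \<le> 1" "reach S n w (a + v)" by blast
    then have "nrm (w - a - u) \<le> 1" by (simp add: algebra_simps)
    then show ?L using *[of "w - a"] w by (intro exI[of _ "w - a"]) auto
  qed
  then show ?case using Suc.prems[of u] by simp
qed

text \<open>\<open>A\<close> consists of the vertices of one walk. That its size is linear in the
  length of the walk is what the density estimate relies on.\<close>

lemma reach_extract:
  assumes "reach S n u v"
  shows "\<exists>A. (\<forall>a\<in>A. S a) \<and> finite A \<and> card A \<le> n + 1 \<and> v \<in> A \<and> (\<forall>a\<in>A. reach (\<lambda>x. x \<in> A) n u a)"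
  using assms
proof (induction n arbitrary: u)
  case 0
  then show ?case by (intro exI[of _ "{u}"]) auto
next
  case (Suc n)
  then obtain w where w: "S u" "nrm (w - u) \<le> 1" "reach S n w v" by auto
  obtain A where A: "\<forall>a\<in>A. S a" "finite A" "card A \<le> n + 1" "v \<in> A"
    "\<forall>a\<in>A. reach (\<lambda>x. x \<in> A) n w a" using Suc.IH[OF w(3)] by blast
  have "reach (\<lambda>x. x \<in> insert u A) (Suc n) u a" if "a \<in> A" for a
    using A(5) that w(2) by (auto intro!: exI[of _ w] elim: reach_mono_set)
  moreover have "reach (\<lambda>x. x \<in> insert u A) (Suc n) u u" by (rule reach_refl) simp
  ultimately show ?case
    using A w(1) by (intro exI[of _ "insert u A"]) (auto simp: card_insert_if)
qed

definition is_link ::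
    "('d::finite vertex \<Rightarrow> bool) \<Rightarrow> nat \<Rightarrow> 'd vertex \<Rightarrow> 'd vertex \<Rightarrow> 'd vertex set \<Rightarrow> bool" where
  "is_link S n u v A \<longleftrightarrow> (\<forall>a\<in>A. S a) \<and> finite A \<and> card A \<le> n + 1 \<and> v \<in> A \<and>
     (\<forall>a\<in>A. reach (\<lambda>x. x \<in> A) n u a)"

definition link :: "('d::finite vertex \<Rightarrow> bool) \<Rightarrow> nat \<Rightarrow> 'd vertex \<Rightarrow> 'd vertex \<Rightarrow> 'd vertex set" where
  "link S n u v = (SOME A. is_link S n u v A)"

lemma is_link_link:
  assumes "reach S n u v"
  shows "is_link S n u v (link S n u v)"
proof -
  have "\<exists>A. is_link S n u v A" unfolding is_link_def by (rule reach_extract[OF assms])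
  then show ?thesis unfolding link_def by (rule someI_ex)
qed

lemma
  assumes "reach S n u v"
  shows link_subset: "a \<in> link S n u v \<Longrightarrow> S a"
    and finite_link: "finite (link S n u v)"
    and card_link: "card (link S n u v) \<le> n + 1"
    and target_in_link: "v \<in> link S n u v"
    and reach_link: "a \<in> link S n u v \<Longrightarrow> reach (\<lambda>x. x \<in> link S n u v) n u a"
  using is_link_link[OF assms] by (simp_all add: is_link_def)

text \<open>\<open>is_link\<close> confines \<open>A\<close> to the ball of radius \<open>n\<close>
  around \<open>u\<close>. Hence the two choices are made from the same predicate and agree.\<close>

lemma link_cong:
  assumes "\<And>x. nrm (x - u) \<le> n \<Longrightarrow> S' x = S x"
  shows "link S' n u v = link S n u v"
proof -
  have "is_link S' n u v A \<longleftrightarrow> is_link S n u v A" for A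
    unfolding is_link_def using assms reach_nrm by blast
  then show ?thesis by (simp add: link_def)
qed

section \<open>Nested connected nets\<close>

definition spacing :: "nat \<Rightarrow> nat" where
  "spacing k = 2 ^ (k * k)"

text \<open>For \<open>k > 0\<close>, links of level \<open>k\<close> join centers at distance at
  most \<open>3 * spacing k\<close>, and walks in the net below cost \<open>3 ^ (k - 1)\<close> per
  unit of distance.\<close>

definition len :: "nat \<Rightarrow> nat" where
  "len k = 3 ^ k * spacing k"

lemma spacing_0 [simp]: "spacing 0 = 1" and len_0 [simp]: "len 0 = 1"
  by (simp_all add: spacing_def len_def)

lemma spacing_pos [simp]: "0 < spacing k"
  by (simp add: spacing_def)

lemma spacing_Suc: "spacing (Suc k) = 2 ^ (2 * k + 1) * spacing k"
proof -
  have "Suc k * Suc k = (2 * k + 1) + k * k" by simp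
  then show ?thesis unfolding spacing_def by (simp only: power_add)
qed

lemma spacing_Suc_ge: "2 * spacing k \<le> spacing (Suc k)"
  by (simp add: spacing_Suc)

lemma spacing_le_len: "spacing k \<le> len k"
  by (simp add: len_def)

lemma len_Suc_ge: "6 * len k \<le> len (Suc k)"
  using spacing_Suc_ge[of k] by (simp add: len_def)

lemma spacing_Suc_le_len: "3 * spacing (Suc k) \<le> len (Suc k)"
  by (simp add: len_def)

definition center :: "nat \<Rightarrow> ('d::finite vertex \<Rightarrow> bool) \<Rightarrow> 'd vertex \<Rightarrow> bool" where
  "center c S v \<longleftrightarrow> S v \<or> (\<forall>w. nrm w \<le> c \<longrightarrow> \<not> S (v + w))"

text \<open>The choice is made among offsets and not among target vertices, so that it commutes with
  translations.\<close>

definition proj :: "nat \<Rightarrow> ('d::finite vertex \<Rightarrow> bool) \<Rightarrow> 'd vertex \<Rightarrow> 'd vertex" where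
  "proj c S v = (if center c S v then v else v + (SOME w. nrm w \<le> c \<and> S (v + w)))"

lemma center_proj: "center c S (proj c S v)"
  and nrm_proj: "nrm (proj c S v - v) \<le> c"
proof -
  have "nrm (SOME w. nrm w \<le> c \<and> S (v + w)) \<le> c \<and> S (v + (SOME w. nrm w \<le> c \<and> S (v + w)))"
    if "\<not> center c S v"
    by (rule someI_ex) (use that in \<open>auto simp: center_def\<close>)
  then show "center c S (proj c S v)" "nrm (proj c S v - v) \<le> c"
    by (auto simp: proj_def center_def)
qed

lemma proj_center: "center c S v \<Longrightarrow> proj c S v = v"
  by (simp add: proj_def)

lemma center_shift:
  assumes "\<And>w. nrm (w - v) \<le> c \<Longrightarrow> S' w = S (a + w)"
  shows "center c S' v \<longleftrightarrow> center c S (a + v)"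
proof -
  have "S' (v + w) = S (a + v + w)" if "nrm w \<le> c" for w
    using assms[of "v + w"] that by (simp add: add.assoc)
  moreover have "S' v = S (a + v)" using assms[of v] by simp
  ultimately show ?thesis by (auto simp: center_def)
qed

lemma proj_shift:
  assumes "\<And>w. nrm (w - v) \<le> c \<Longrightarrow> S' w = S (a + w)"
  shows "a + proj c S' v = proj c S (a + v)"
proof -
  have "(\<lambda>w. nrm w \<le> c \<and> S' (v + w)) = (\<lambda>w. nrm w \<le> c \<and> S (a + v + w))"
    using assms[of "v + w" for w] by (auto simp: fun_eq_iff add.assoc)
  moreover have "center c S' v \<longleftrightarrow> center c S (a + v)" using assms by (rule center_shift)
  ultimately show ?thesis by (simp add: proj_def add.assoc)
qed

type_synonym 'd config = "nat \<Rightarrow> 'd vertex \<Rightarrow> bool"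

text \<open>Passes from \<open>v\<close> to a center of level \<open>k\<close>, from there to one of
  level \<open>k - 1\<close>, and so on down to level 1. A center need not lie in any given net; its
  anchor of level \<open>k\<close> does lie in \<open>net B k\<close> and represents it
  there.\<close>

primrec anchor :: "'d::finite config \<Rightarrow> nat \<Rightarrow> 'd vertex \<Rightarrow> 'd vertex" where
  "anchor B 0 v = v"
| "anchor B (Suc k) v = anchor B k (proj (spacing (Suc k)) (B (Suc k)) v)"

text \<open>
  Every choice is made in coordinates relative to the endpoint \<open>x\<close> of a link, which makes the
  construction commute with translations.
\<close>

definition rel_link :: "('d::finite vertex \<Rightarrow> bool) \<Rightarrow> ('d vertex \<Rightarrow> 'd vertex) \<Rightarrow> nat \<Rightarrow>
    'd vertex \<Rightarrow> 'd vertex \<Rightarrow> 'd vertex set" where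
  "rel_link S \<phi> n x z = link (\<lambda>w. S (x + w)) n (\<phi> x - x) (\<phi> (x + z) - x)"

text \<open>The factor 3 leaves room for the projections of two vertices at distance at most
  \<open>spacing (Suc k)\<close>: each projection moves its vertex by at most that much
  again.\<close>

primrec net :: "'d::finite config \<Rightarrow> nat \<Rightarrow> 'd vertex \<Rightarrow> bool" where
  "net B 0 = (\<lambda>v. True)"
| "net B (Suc k) = (\<lambda>v. \<exists>x z. nrm z \<le> 3 * spacing (Suc k) \<and>
     center (spacing (Suc k)) (B (Suc k)) x \<and> center (spacing (Suc k)) (B (Suc k)) (x + z) \<and>
     v - x \<in> rel_link (net B k) (anchor B k) (len (Suc k)) x z)"

text \<open>The spacings at least double from level to level, so the displacements are dominated by
  a geometric series.\<close>

lemma nrm_anchor: "nrm (anchor B k v - v) \<le> 2 * spacing k"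
proof (induction k arbitrary: v)
  case (Suc k)
  let ?p = "proj (spacing (Suc k)) (B (Suc k)) v"
  show ?case
    using Suc.IH[of ?p] nrm_proj[of "spacing (Suc k)" "B (Suc k)" v] spacing_Suc_ge[of k]
      nrm_triangle_diff[of "anchor B k ?p" v ?p] by simp
qed auto

section \<open>Connectivity of the nets\<close>

lemma reach_chain:
  assumes step: "\<And>u v. nrm (v - u) \<le> c \<Longrightarrow> reach S l (\<phi> u) (\<phi> v)"
    and "nrm (v - u) \<le> Suc n * c"
  shows "reach S (Suc n * l) (\<phi> u) (\<phi> v)"
  using assms(2)
proof (induction n arbitrary: u)
  case 0
  then show ?case using step[of v u] by simp
next
  case (Suc n)
  then obtain w where w: "nrm w \<le> c" "nrm ((v - u) - w) \<le> Suc n * c"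
    using nrm_split[of "v - u" c "Suc n * c"] by (auto simp: add.commute)
  have "reach S l (\<phi> u) (\<phi> (u + w))" using w(1) by (intro step) simp
  moreover have "reach S (Suc n * l) (\<phi> (u + w)) (\<phi> v)"
    using w(2) by (intro Suc.IH) (simp add: algebra_simps)
  ultimately show ?case using reach_trans by fastforce
qed

text \<open>A distance of \<open>m * spacing (Suc k)\<close> is cut into
  \<open>m * 2 ^ (2 * k + 1)\<close> hops of length \<open>spacing k\<close>, each costing
  \<open>len k\<close> steps. The bound for one hop is a hypothesis because the induction for
  \<open>reach_net_anchor\<close> calls this lemma with its induction hypothesis.\<close>

lemma reach_anchor_le:
  assumes "\<And>u v. nrm (v - u) \<le> spacing k \<Longrightarrow> reach (net B k) (len k) (anchor B k u) (anchor B k v)"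
    and "nrm (v - u) \<le> m * spacing (Suc k)" "0 < m"
  shows "reach (net B k) (m * 3 ^ k * spacing (Suc k)) (anchor B k u) (anchor B k v)"
proof -
  let ?n = "m * 2 ^ (2 * k + 1) - 1"
  have n: "Suc ?n = m * 2 ^ (2 * k + 1)" using assms(3) by simp
  have "nrm (v - u) \<le> Suc ?n * spacing k" using assms(2) unfolding n by (simp add: spacing_Suc mult.assoc)
  from reach_chain[OF assms(1) this] show ?thesis
    unfolding n by (simp add: spacing_Suc len_def mult_ac)
qed

lemma rel_link_reach:
  assumes "reach (net B k) n (anchor B k x) (anchor B k (x + z))"
  shows "reach (\<lambda>w. net B k (x + w)) n (anchor B k x - x) (anchor B k (x + z) - x)"
  using assms by (subst reach_shift[of _ _ _ "net B k" x]) auto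

text \<open>Project both vertices to centers of level \<open>Suc k\<close>. These are at distance at
  most \<open>3 * spacing (Suc k)\<close>, so by induction their anchors are joined in
  \<open>net B k\<close> by a walk of length \<open>len (Suc k)\<close>; the chosen link between
  them belongs to \<open>net B (Suc k)\<close> by construction.\<close>

lemma reach_net_anchor:
  "nrm (v - u) \<le> spacing k \<Longrightarrow> reach (net B k) (len k) (anchor B k u) (anchor B k v)"
proof (induction k arbitrary: u v)
  case 0
  then show ?case using reach_UNIV[of v u 1] by simp
next
  case (Suc k)
  let ?c = "spacing (Suc k)" and ?n = "len (Suc k)"
  let ?x = "proj ?c (B (Suc k)) u" and ?y = "proj ?c (B (Suc k)) v"
  let ?z = "?y - ?x"
  have z: "nrm ?z \<le> 3 * ?c"
    using nrm_triangle_diff[of ?y ?x v] nrm_triangle_diff[of v ?x u] Suc.prems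
      nrm_proj[of ?c "B (Suc k)" u] nrm_proj[of ?c "B (Suc k)" v] nrm_minus_commute[of u ?x]
    by linarith
  have "reach (net B k) ?n (anchor B k ?x) (anchor B k (?x + ?z))"
    using reach_anchor_le[OF Suc.IH, of ?y ?x 3] z by (simp add: len_def mult_ac)
  then have R: "reach (\<lambda>w. net B k (?x + w)) ?n (anchor B k ?x - ?x) (anchor B k (?x + ?z) - ?x)"
    by (rule rel_link_reach)
  let ?A = "rel_link (net B k) (anchor B k) ?n ?x ?z"
  have "reach (\<lambda>w. w \<in> ?A) ?n (anchor B k ?x - ?x) (anchor B k (?x + ?z) - ?x)"
    using reach_link[OF R target_in_link[OF R]] unfolding rel_link_def .
  then have "reach (\<lambda>w. w - ?x \<in> ?A) ?n (?x + (anchor B k ?x - ?x)) (?x + (anchor B k (?x + ?z) - ?x))"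
    by (subst reach_shift[symmetric, of _ _ "\<lambda>w. w \<in> ?A"]) auto
  then have "reach (\<lambda>w. w - ?x \<in> ?A) ?n (anchor B k ?x) (anchor B k ?y)" by simp
  then have "reach (net B (Suc k)) ?n (anchor B k ?x) (anchor B k ?y)"
  proof (rule reach_mono_set)
    fix w assume "w - ?x \<in> ?A"
    moreover have "?x + ?z = ?y" by simp
    ultimately show "net B (Suc k) w"
      unfolding net.simps using z center_proj[of ?c "B (Suc k)"] by metis
  qed
  then show ?case by simp
qed

lemma reach_net_anchor_Suc:
  assumes "nrm (v - u) \<le> m * spacing (Suc k)" "0 < m"
  shows "reach (net B k) (m * 3 ^ k * spacing (Suc k)) (anchor B k u) (anchor B k v)"
  by (rule reach_anchor_le[OF reach_net_anchor assms])

lemma reach_rel_link: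
  assumes "nrm z \<le> 3 * spacing (Suc k)"
  shows "reach (\<lambda>w. net B k (x + w)) (len (Suc k)) (anchor B k x - x) (anchor B k (x + z) - x)"
  using reach_net_anchor_Suc[of "x + z" x 3 k B] assms
  by (intro rel_link_reach) (simp add: len_def mult_ac)

lemma rel_link_near:
  assumes "nrm z \<le> 3 * spacing (Suc k)" "w \<in> rel_link (net B k) (anchor B k) (len (Suc k)) x z"
  shows "nrm w \<le> 2 * len (Suc k)"
proof -
  have "nrm (w - (anchor B k x - x)) \<le> len (Suc k)"
    using reach_link[OF reach_rel_link[OF assms(1)]] assms(2) reach_nrm unfolding rel_link_def by blast
  moreover have "nrm (anchor B k x - x) \<le> len (Suc k)"
    using nrm_anchor[of B k x] spacing_le_len[of k] len_Suc_ge[of k] by linarith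
  ultimately show ?thesis using nrm_le_add_diff[of w "anchor B k x - x"] by linarith
qed

lemma card_rel_link:
  assumes "nrm z \<le> 3 * spacing (Suc k)"
  shows "card (rel_link (net B k) (anchor B k) (len (Suc k)) x z) \<le> len (Suc k) + 1"
  unfolding rel_link_def by (rule card_link[OF reach_rel_link[OF assms]])

lemma finite_rel_link:
  assumes "nrm z \<le> 3 * spacing (Suc k)"
  shows "finite (rel_link (net B k) (anchor B k) (len (Suc k)) x z)"
  unfolding rel_link_def by (rule finite_link[OF reach_rel_link[OF assms]])

lemma net_Suc_subset: "net B (Suc k) v \<Longrightarrow> net B k v"
  using link_subset[OF reach_rel_link, of _ k _ B] by (fastforce simp: rel_link_def)

lemma net_antimono: "j \<le> k \<Longrightarrow> net B k v \<Longrightarrow> net B j v"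
  by (induction k rule: dec_induct) (auto dest: net_Suc_subset simp del: net.simps)

definition dur :: "nat \<Rightarrow> nat" where
  "dur k = len k + 3 ^ k * spacing (Suc k)"

lemma dur_pos: "0 < dur k"
  by (simp add: dur_def)

text \<open>From \<open>v\<close>, follow its link back to the anchor where it begins, in
  \<open>len k\<close> steps. Then walk to the anchor of the level \<open>Suc k\<close> projection,
  which lies in the next net, in \<open>3 ^ k * spacing (Suc k)\<close> steps. \<open>dur k\<close>
  adds up the two.\<close>

lemma net_reaches_next:
  assumes "net B k v"
  shows "\<exists>w. net B (Suc k) w \<and> reach (net B k) (dur k) v w"
proof -
  obtain x where x: "reach (net B k) (len k) (anchor B k x) v"
  proof (cases k)
    case 0
    then show ?thesis using assms that[of v] by (auto intro: reach_refl)
  next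
    case (Suc j)
    then obtain x z where xz: "nrm z \<le> 3 * spacing k" "center (spacing k) (B k) x"
      "center (spacing k) (B k) (x + z)" "v - x \<in> rel_link (net B j) (anchor B j) (len k) x z"
      using assms by auto
    let ?A = "rel_link (net B j) (anchor B j) (len k) x z"
    have "reach (\<lambda>w. w \<in> ?A) (len k) (anchor B j x - x) (v - x)"
      using reach_link[OF reach_rel_link] xz(1,4) unfolding rel_link_def Suc by blast
    then have "reach (\<lambda>w. w - x \<in> ?A) (len k) (x + (anchor B j x - x)) (x + (v - x))"
      by (subst reach_shift[symmetric, of _ _ "\<lambda>w. w \<in> ?A"]) auto
    then have "reach (\<lambda>w. w - x \<in> ?A) (len k) (anchor B j x) v" by simp
    then have "reach (net B k) (len k) (anchor B j x) v"
    proof (rule reach_mono_set)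
      fix w assume "w - x \<in> ?A"
      then show "net B k w"
        unfolding Suc net.simps using xz(1-3) unfolding Suc by (intro exI[of _ x] exI[of _ z] conjI)
    qed
    moreover have "anchor B k x = anchor B j x"
      using xz(2) by (simp add: Suc proj_center)
    ultimately show ?thesis using that by metis
  qed
  let ?p = "proj (spacing (Suc k)) (B (Suc k)) x"
  have "reach (net B k) (3 ^ k * spacing (Suc k)) (anchor B k x) (anchor B k ?p)"
    using reach_net_anchor_Suc[of ?p x 1 k B] nrm_proj[of "spacing (Suc k)" "B (Suc k)" x] by simp
  then have "reach (net B k) (dur k) v (anchor B (Suc k) x)"
    using reach_trans[OF reach_sym[OF x]] by (simp add: dur_def)
  moreover have "net B (Suc k) (anchor B (Suc k) x)"
    using reach_source[OF reach_net_anchor[of x x "Suc k" B]] by simp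
  ultimately show ?thesis by blast
qed

section \<open>Locality and translation invariance of the nets\<close>

definition looks_like :: "nat \<Rightarrow> nat \<Rightarrow> 'd::finite vertex \<Rightarrow> 'd config \<Rightarrow> 'd config \<Rightarrow> bool" where
  "looks_like k r a B' B \<longleftrightarrow> (\<forall>j\<le>k. \<forall>v. nrm v \<le> r \<longrightarrow> B' j v = B j (a + v))"

lemma looks_like_mono: "looks_like k r a B' B \<Longrightarrow> j \<le> k \<Longrightarrow> looks_like j r a B' B"
  by (auto simp: looks_like_def)

lemma looks_like_near:
  assumes "looks_like k r a B' B" "nrm v + n \<le> r" "nrm (w - v) \<le> n" "j \<le> k"
  shows "B' j w = B j (a + w)"
  using assms nrm_le_add_diff[of w v] unfolding looks_like_def by (meson add_left_mono le_trans)

text \<open>A link through \<open>v\<close> begins at an \<open>x\<close> within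
  \<open>2 * len (Suc k)\<close> of \<open>v\<close>, and another \<open>2 * len (Suc k)\<close>
  beyond \<open>x\<close>, plus the range of the lower net, covers all that determines the link and
  whether its ends are centers.\<close>

primrec net_range :: "nat \<Rightarrow> nat" where
  "net_range 0 = 0"
| "net_range (Suc k) = net_range k + 4 * len (Suc k)"

lemma net_range_le: "net_range k \<le> 8 * len k"
proof (induction k)
  case (Suc k)
  then show ?case using len_Suc_ge[of k] by simp
qed simp

lemma anchor_looks_like:
  assumes "looks_like k r a B' B" "nrm v + net_range k \<le> r"
  shows "a + anchor B' k v = anchor B k (a + v)"
  using assms
proof (induction k arbitrary: v)
  case (Suc k)
  let ?c = "spacing (Suc k)"
  let ?p = "proj ?c (B' (Suc k)) v"
  have c: "?c \<le> len (Suc k)" by (rule spacing_le_len)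
  have p: "nrm ?p \<le> nrm v + ?c"
    using nrm_proj[of ?c "B' (Suc k)" v] nrm_le_add_diff[of ?p v] by linarith
  have "a + ?p = proj ?c (B (Suc k)) (a + v)"
    by (rule proj_shift, rule looks_like_near[OF Suc.prems(1), where n = ?c and v = v])
      (use Suc.prems c in auto)
  moreover have "a + anchor B' k ?p = anchor B k (a + ?p)"
    using Suc.prems p c by (intro Suc.IH looks_like_mono[OF Suc.prems(1)]) auto
  ultimately show ?case by simp
qed simp

text \<open>Agreement of the lower nets is a hypothesis, so that the induction for
  \<open>net_looks_like\<close> can supply it.\<close>

lemma rel_link_net_cong:
  assumes ll: "looks_like k r a B' B"
    and net: "\<And>v. nrm v + net_range k \<le> r \<Longrightarrow> net B' k v = net B k (a + v)"
    and r: "nrm x + net_range k + 2 * len (Suc k) \<le> r" and z: "nrm z \<le> 3 * spacing (Suc k)"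
  shows "rel_link (net B' k) (anchor B' k) (len (Suc k)) x z =
    rel_link (net B k) (anchor B k) (len (Suc k)) (a + x) z"
proof -
  let ?l = "len (Suc k)"
  have "nrm (x + z) \<le> nrm x + ?l"
    using z spacing_Suc_le_len[of k] nrm_triangle[of x z] by linarith
  then have az: "a + anchor B' k (x + z) = anchor B k (a + (x + z))"
    using r by (intro anchor_looks_like[OF ll]) auto
  have ax: "a + anchor B' k x = anchor B k (a + x)"
    using r by (intro anchor_looks_like[OF ll]) auto
  have "anchor B' k x - x = anchor B k (a + x) - (a + x)"
    using ax by (simp add: algebra_simps)
  moreover have "anchor B' k (x + z) - x = anchor B k (a + x + z) - (a + x)"
    using az by (simp add: algebra_simps)
  moreover have "link (\<lambda>w. net B' k (x + w)) ?l (anchor B' k x - x) q =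
      link (\<lambda>w. net B k (a + x + w)) ?l (anchor B' k x - x) q" for q
  proof (rule link_cong)
    fix w assume w: "nrm (w - (anchor B' k x - x)) \<le> ?l"
    have "nrm w \<le> ?l + 2 * spacing k"
      using w nrm_le_add_diff[of w "anchor B' k x - x"] nrm_anchor[of B' k x] by linarith
    then have "nrm (x + w) + net_range k \<le> r"
      using r nrm_triangle[of x w] spacing_le_len[of k] len_Suc_ge[of k] by linarith
    then show "net B' k (x + w) = net B k (a + x + w)"
      using net by (simp add: add.assoc)
  qed
  ultimately show ?thesis unfolding rel_link_def by metis
qed

lemma net_looks_like:
  assumes "looks_like k r a B' B" "nrm v + net_range k \<le> r"
  shows "net B' k v \<longleftrightarrow> net B k (a + v)"
  using assms
proof (induction k arbitrary: v)
  case (Suc k)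
  let ?c = "spacing (Suc k)" and ?l = "len (Suc k)"
  have c: "3 * ?c \<le> ?l" by (rule spacing_Suc_le_len)
  have ll: "looks_like k r a B' B" using Suc.prems(1) by (rule looks_like_mono) simp
  have r: "nrm v + net_range k + 4 * ?l \<le> r" using Suc.prems by simp
  define P where "P B v x z \<longleftrightarrow> center ?c (B (Suc k)) x \<and> center ?c (B (Suc k)) (x + z) \<and>
     v - x \<in> rel_link (net B k) (anchor B k) ?l x z" for B and v x z :: "'a vertex"
  have P_iff: "P B' v x z \<longleftrightarrow> P B (a + v) (a + x) z" if z: "nrm z \<le> 3 * ?c" and x: "nrm (v - x) \<le> 2 * ?l" for x z
  proof -
    have nx: "nrm x \<le> nrm v + 2 * ?l"
      using x nrm_le_add_diff[of x v] nrm_minus_commute[of x v] by linarith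
    have nxz: "nrm (x + z) \<le> nrm v + 3 * ?l"
      using nx z c nrm_triangle[of x z] by linarith
    have "center ?c (B' (Suc k)) x \<longleftrightarrow> center ?c (B (Suc k)) (a + x)"
      by (rule center_shift, rule looks_like_near[OF Suc.prems(1), where n = ?c and v = x])
        (use nx r c in auto)
    moreover have "center ?c (B' (Suc k)) (x + z) \<longleftrightarrow> center ?c (B (Suc k)) (a + (x + z))"
      by (rule center_shift, rule looks_like_near[OF Suc.prems(1), where n = ?c and v = "x + z"])
        (use nxz r c in auto)
    moreover have "rel_link (net B' k) (anchor B' k) ?l x z = rel_link (net B k) (anchor B k) ?l (a + x) z"
      using nx r by (intro rel_link_net_cong[OF ll Suc.IH[OF ll]] z) auto
    ultimately show ?thesis by (simp add: P_def add.assoc)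
  qed
  \<comment> \<open>Only endpoints near \<open>v\<close> can be witnesses, so the unbounded
    quantifiers over \<open>x\<close> may be compared by looking at a bounded region.\<close>
  have near: "nrm (v - x) \<le> 2 * ?l" if "P B v x z" "nrm z \<le> 3 * ?c" for B and v x z :: "'a vertex"
    using that rel_link_near[of z k _ B x] by (auto simp: P_def)
  have "(\<exists>x z. nrm z \<le> 3 * ?c \<and> P B' v x z) \<longleftrightarrow> (\<exists>x z. nrm z \<le> 3 * ?c \<and> P B (a + v) x z)"
  proof safe
    fix x z assume "nrm z \<le> 3 * ?c" "P B' v x z"
    then show "\<exists>x z. nrm z \<le> 3 * ?c \<and> P B (a + v) x z" using P_iff near by blast
  next
    fix x z assume z: "nrm z \<le> 3 * ?c" and P: "P B (a + v) x z"
    have "nrm (v - (x - a)) \<le> 2 * ?l" using near[OF P z] by (simp add: algebra_simps)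
    then have "P B' v (x - a) z" using P_iff[OF z] P by simp
    then show "\<exists>x z. nrm z \<le> 3 * ?c \<and> P B' v x z" using z by blast
  qed
  then show ?case by (simp add: P_def)
qed simp

lemma rel_link_looks_like:
  assumes "looks_like k r a B' B" "nrm x + net_range k + 2 * len (Suc k) \<le> r"
    and "nrm z \<le> 3 * spacing (Suc k)"
  shows "rel_link (net B' k) (anchor B' k) (len (Suc k)) x z =
    rel_link (net B k) (anchor B k) (len (Suc k)) (a + x) z"
  by (rule rel_link_net_cong[OF assms(1) net_looks_like[OF assms(1)] assms(2,3)])

section \<open>Shrinking the nets one step at a time\<close>

primrec start :: "nat \<Rightarrow> nat" where
  "start 0 = 0"
| "start (Suc k) = start k + dur k"

lemma start_mono: "j \<le> k \<Longrightarrow> start j \<le> start k"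
  by (induction k rule: dec_induct) auto

text \<open>\<open>3 ^ k * spacing (Suc k)\<close> is a third of \<open>len (Suc k)\<close>;
  \<open>start k\<close> and \<open>len k\<close> together contribute at most another third.\<close>

lemma start_le_len: "start k \<le> len k"
proof (induction k)
  case (Suc k)
  have "3 * (3 ^ k * spacing (Suc k)) = len (Suc k)" by (simp add: len_def)
  then show ?case using Suc len_Suc_ge[of k] unfolding start.simps dur_def by linarith
qed simp

text \<open>
  A refinement of the sequence of nets: \<open>stage (start k)\<close> is \<open>net k\<close>, and between \<open>start k\<close> and
  \<open>start (Suc k)\<close> the stages shrink towards \<open>net (Suc k)\<close> by one step at a time. For the levels that
  are already completed at time \<open>t\<close>, the truncated difference is 0 and the condition says \<open>net (Suc k) v\<close>.
\<close>

definition stage :: "'d::finite config \<Rightarrow> nat \<Rightarrow> 'd vertex \<Rightarrow> bool" where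
  "stage B t v \<longleftrightarrow> (\<forall>k. start k \<le> t \<longrightarrow>
     (\<exists>w. net B (Suc k) w \<and> reach (net B k) (start (Suc k) - t) v w))"

lemma stage_0: "stage B 0 v"
proof -
  have "k = 0" if "start k \<le> 0" for k
    using that dur_pos[of "k - 1"] by (cases k) auto
  moreover obtain w where "net B (Suc 0) w" "reach (net B 0) (start (Suc 0) - 0) v w"
    using net_reaches_next[of B 0 v] by auto
  ultimately show ?thesis unfolding stage_def by blast
qed

lemma stage_Suc: "stage B (Suc t) v \<Longrightarrow> stage B t v"
  unfolding stage_def
proof (intro allI impI)
  fix k assume *: "\<forall>k. start k \<le> Suc t \<longrightarrow>
      (\<exists>w. net B (Suc k) w \<and> reach (net B k) (start (Suc k) - Suc t) v w)" "start k \<le> t"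
  then obtain w where w: "net B (Suc k) w" "reach (net B k) (start (Suc k) - Suc t) v w"
    by (meson le_SucI)
  have "reach (net B k) (start (Suc k) - t) v w" by (rule reach_mono[OF w(2)]) simp
  then show "\<exists>w. net B (Suc k) w \<and> reach (net B k) (start (Suc k) - t) v w" using w(1) by blast
qed

lemma stage_start_net: "stage B (start k) v \<Longrightarrow> net B k v"
  unfolding stage_def by (metis order_refl reach_source)

text \<open>If \<open>v\<close> drops out, the walk from \<open>v\<close> to the next net takes all
  the steps still allowed. Its first step leads to a vertex that is one step closer and hence
  survives.\<close>

lemma stage_step:
  assumes t: "stage B t v" and nt: "\<not> stage B (Suc t) v"
  shows "\<exists>u. nrm (u - v) = 1 \<and> stage B (Suc t) u"
proof -
  have t': "\<exists>w. net B (Suc k) w \<and> reach (net B k) (start (Suc k) - t) v w" if "start k \<le> t" for k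
    using t that by (auto simp: stage_def)
  \<comment> \<open>The failing level has already begun at time \<open>t\<close>: at a level that
    begins exactly at \<open>Suc t\<close>, the walks from \<open>net_reaches_next\<close> have the
    full duration available.\<close>
  have "\<exists>k. start k \<le> t \<and> \<not> (\<exists>w. net B (Suc k) w \<and> reach (net B k) (start (Suc k) - Suc t) v w)"
  proof (rule ccontr)
    assume *: "\<not> ?thesis"
    obtain k where k: "start k \<le> Suc t"
      "\<not> (\<exists>w. net B (Suc k) w \<and> reach (net B k) (start (Suc k) - Suc t) v w)"
      using nt by (auto simp: stage_def)
    then have kt: "start k = Suc t" using * by (metis le_SucE)
    then obtain j where j: "k = Suc j" by (cases k) auto
    have "start j \<le> t" using kt dur_pos[of j] by (simp add: j)
    then have "net B k v" using * kt unfolding j by (metis diff_self_eq_0 reach.simps(1))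
    from net_reaches_next[OF this] show False using k(2) kt by simp
  qed
  then obtain k where k: "start k \<le> t"
    "\<not> (\<exists>w. net B (Suc k) w \<and> reach (net B k) (start (Suc k) - Suc t) v w)" by blast
  obtain w where w: "net B (Suc k) w" "reach (net B k) (start (Suc k) - t) v w"
    using t'[OF k(1)] by blast
  \<comment> \<open>A completed level cannot fail, since its condition is the same at
    \<open>t\<close> and at \<open>Suc t\<close>.\<close>
  have lt: "t < start (Suc k)"
  proof (rule ccontr)
    assume "\<not> t < start (Suc k)"
    then have "start (Suc k) - t = 0" "start (Suc k) - Suc t = 0" by simp_all
    then show False using w k(2) by metis
  qed
  then have "start (Suc k) - t = Suc (start (Suc k) - Suc t)" by simp
  with w obtain u where u: "nrm (u - v) \<le> 1" "reach (net B k) (start (Suc k) - Suc t) u w"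
    by (auto simp del: start.simps)
  have "u \<noteq> v" using u(2) w(1) k(2) by blast
  then have "nrm (u - v) = 1" using u(1) by (cases "nrm (u - v)") auto
  moreover have "stage B (Suc t) u"
    unfolding stage_def
  proof (intro allI impI)
    fix j assume j: "start j \<le> Suc t"
    consider "j = k" | "j < k" | "k < j" by linarith
    then show "\<exists>w. net B (Suc j) w \<and> reach (net B j) (start (Suc j) - Suc t) u w"
    proof cases
      case 1
      then show ?thesis using u(2) w(1) by blast
    next
      case 2
      then have "start (Suc j) \<le> start k" by (intro start_mono) simp
      then have "start (Suc j) - Suc t = 0" using k(1) by linarith
      moreover have "net B (Suc j) u"
        by (rule net_antimono[OF _ reach_source[OF u(2)]]) (use 2 in simp)
      ultimately show ?thesis
        using net_Suc_subset by (metis reach.simps(1))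
    next
      case 3
      \<comment> \<open>A later level \<open>j\<close> can only have begun if \<open>k\<close> ends
        exactly at \<open>Suc t\<close>. Then no steps remain in the walk, so \<open>u\<close> is
        already in \<open>net B (Suc k)\<close> and the next level starts from there.\<close>
      then have "start (Suc k) \<le> start j" by (intro start_mono) simp
      then have st: "start (Suc k) = Suc t" "start j = start (Suc k)" using lt j by linarith+
      have "j = Suc k"
      proof (rule ccontr)
        assume "j \<noteq> Suc k"
        then have "start (Suc (Suc k)) \<le> start j" using 3 by (intro start_mono) simp
        then show False using st(2) dur_pos[of "Suc k"] by simp
      qed
      moreover have "net B (Suc k) u" using u(2) w(1) st(1) by simp
      ultimately show ?thesis
        using net_reaches_next[of B j u] st by simp
    qed
  qed
  ultimately show ?thesis by blast
qed

text \<open>\<open>start\<close> is strictly increasing, so up to time \<open>start m\<close> only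
  the levels \<open>k \<le> m\<close> have begun, and these involve no net beyond level
  \<open>Suc m\<close>.\<close>

lemma stage_looks_like:
  assumes ll: "looks_like (Suc m) r a B' B" and "t \<le> start m"
    and r: "nrm v + start (Suc m) + net_range (Suc m) \<le> r"
  shows "stage B' t v \<longleftrightarrow> stage B t (a + v)"
proof -
  have *: "(\<exists>w. net B' (Suc k) w \<and> reach (net B' k) (start (Suc k) - t) v w) \<longleftrightarrow>
      (\<exists>w. net B (Suc k) w \<and> reach (net B k) (start (Suc k) - t) (a + v) w)"
    if "start k \<le> t" for k
  proof -
    have "k \<le> m"
    proof (rule ccontr)
      assume "\<not> k \<le> m"
      then have "start (Suc m) \<le> start k" by (intro start_mono) simp
      then show False using that assms(2) dur_pos[of m] by simp
    qed
    then have st: "start (Suc k) \<le> start (Suc m)" by (intro start_mono) simp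
    have nr: "net_range i \<le> net_range j" if "i \<le> j" for i j
      using that by (induction j rule: dec_induct) auto
    define n where "n = start (Suc k) - t"
    have net: "net B' j w = net B j (a + w)" if "nrm (w - v) \<le> n" "j \<le> Suc k" for j w
    proof (rule net_looks_like[OF looks_like_mono[OF ll]])
      show "j \<le> Suc m" using that \<open>k \<le> m\<close> by simp
      then show "nrm w + net_range j \<le> r"
        using that nrm_le_add_diff[of w v] st r nr[of j "Suc m"] unfolding n_def
        by linarith
    qed
    have re: "reach (net B' k) n v w = reach (net B k) n (a + v) (a + w)" for w
      by (rule reach_shift) (simp add: net)
    have "(\<exists>w. net B' (Suc k) w \<and> reach (net B' k) n v w) \<longleftrightarrow>
        (\<exists>w. net B (Suc k) (a + w) \<and> reach (net B k) n (a + v) (a + w))"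
      using re net[of _ "Suc k"] reach_nrm by blast
    also have "\<dots> \<longleftrightarrow> (\<exists>w. net B (Suc k) w \<and> reach (net B k) n (a + v) w)"
      by (metis add.commute diff_add_cancel)
    finally show ?thesis unfolding n_def .
  qed
  show ?thesis unfolding stage_def using * by blast
qed

section \<open>Matching along a forest with finite past\<close>

lemma fixed_point_free_involution_exists:
  assumes "finite A" "even (card A)"
  shows "\<exists>g. \<forall>a\<in>A. g a \<in> A \<and> g a \<noteq> a \<and> g (g a) = a"
  using assms
proof (induction "card A" arbitrary: A rule: less_induct)
  case less
  show ?case
  proof (cases "A = {}")
    case False
    then obtain a where a: "a \<in> A" by blast
    have "card A \<noteq> 1" using less.prems(2) by auto
    then have "A - {a} \<noteq> {}" using a card_1_singleton_iff[of A] by force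
    then obtain b where b: "b \<in> A" "b \<noteq> a" by blast
    have c: "card A = card (A - {a, b}) + 2"
      using a b less.prems(1) card_Diff_subset[of "{a, b}" A] card_mono[of A "{a, b}"] by auto
    then obtain g where g: "\<forall>x\<in>A - {a, b}. g x \<in> A - {a, b} \<and> g x \<noteq> x \<and> g (g x) = x"
      using less.hyps[of "A - {a, b}"] less.prems by auto
    show ?thesis
      by (rule exI[of _ "\<lambda>x. if x = a then b else if x = b then a else g x"])
        (use g a b in auto)
  qed auto
qed

definition pairing :: "'a set \<Rightarrow> 'a \<Rightarrow> 'a" where
  "pairing A = (SOME g. \<forall>a\<in>A. g a \<in> A \<and> g a \<noteq> a \<and> g (g a) = a)"

lemma
  assumes "finite A" "even (card A)" "a \<in> A"
  shows pairing_mem: "pairing A a \<in> A"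
    and pairing_neq: "pairing A a \<noteq> a"
    and pairing_pairing: "pairing A (pairing A a) = a"
proof -
  have "\<forall>a\<in>A. pairing A a \<in> A \<and> pairing A a \<noteq> a \<and> pairing A (pairing A a) = a"
    unfolding pairing_def
    by (rule someI_ex[OF fixed_point_free_involution_exists[OF assms(1,2)]])
  then show "pairing A a \<in> A" "pairing A a \<noteq> a" "pairing A (pairing A a) = a"
    using assms(3) by simp_all
qed

text \<open>The parent is a neighbour that stays in the sets \<open>S t\<close> longer than
  \<open>v\<close>. A vertex that never leaves has no such neighbour to offer in general and gets
  itself as a default.\<close>

definition parent :: "(nat \<Rightarrow> 'd::finite vertex \<Rightarrow> bool) \<Rightarrow> 'd vertex \<Rightarrow> 'd vertex" where
  "parent S v = (if \<forall>t. S t v then v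
     else v + (SOME w. nrm w = 1 \<and> (\<exists>t. \<not> S t v \<and> S t (v + w))))"

text \<open>The tree recursion is run on an auxiliary depth \<open>n\<close>. The start value is
  arbitrary: by \<open>unmatched_at_stable\<close>, it is forgotten once \<open>n\<close> reaches a
  time at which \<open>v\<close> has left.\<close>

primrec unmatched_at :: "(nat \<Rightarrow> 'd::finite vertex \<Rightarrow> bool) \<Rightarrow> nat \<Rightarrow> 'd vertex \<Rightarrow> bool" where
  "unmatched_at S 0 v = False"
| "unmatched_at S (Suc n) v = even (card {u. parent S u = v \<and> unmatched_at S n u})"

text \<open>
  \<open>unmatched S v\<close> says that \<open>v\<close> is left over after its descendants have been matched: then an even
  number of its children is left over, and these are paired off without using \<open>v\<close>.
\<close>

definition unmatched :: "(nat \<Rightarrow> 'd::finite vertex \<Rightarrow> bool) \<Rightarrow> 'd vertex \<Rightarrow> bool" where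
  "unmatched S v = (\<exists>n. \<forall>m\<ge>n. unmatched_at S m v)"

text \<open>The cells partition the vertices into sets of diameter at most 2, each made up of the
  left over children of \<open>w\<close>, and of \<open>w\<close> itself if it is used up by them.
  The matching pairs vertices within each cell.\<close>

definition cell :: "(nat \<Rightarrow> 'd::finite vertex \<Rightarrow> bool) \<Rightarrow> 'd vertex \<Rightarrow> 'd vertex set" where
  "cell S w = {u. parent S u = w \<and> unmatched S u} \<union> {u. u = w \<and> \<not> unmatched S u}"

definition cell_root :: "(nat \<Rightarrow> 'd::finite vertex \<Rightarrow> bool) \<Rightarrow> 'd vertex \<Rightarrow> 'd vertex" where
  "cell_root S v = (if unmatched S v then parent S v else v)"

text \<open>The pairing is applied to offsets from the root of the cell. As \<open>pairing\<close>
  depends on the set of offsets alone, the result commutes with translations.\<close>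

definition partner :: "(nat \<Rightarrow> 'd::finite vertex \<Rightarrow> bool) \<Rightarrow> 'd vertex \<Rightarrow> 'd vertex" where
  "partner S v = (let w = cell_root S v in w + pairing {u. w + u \<in> cell S w} (v - w))"

locale filtration =
  fixes S :: "nat \<Rightarrow> 'd::finite vertex \<Rightarrow> bool"
  assumes S_0: "S 0 v"
    and S_Suc: "S (Suc t) v \<Longrightarrow> S t v"
    and S_step: "S t v \<Longrightarrow> \<not> S (Suc t) v \<Longrightarrow> \<exists>u. nrm (u - v) = 1 \<and> S (Suc t) u"
begin

lemma S_antimono: "s \<le> t \<Longrightarrow> S t v \<Longrightarrow> S s v"
  by (induction t rule: dec_induct) (auto dest: S_Suc)

lemma parent_bad: "\<forall>t. S t v \<Longrightarrow> parent S v = v"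
  by (simp add: parent_def)

lemma parent_good:
  assumes "\<not> S t v"
  shows "nrm (parent S v - v) = 1 \<and> (\<exists>s. \<not> S s v \<and> S s (parent S v))"
proof -
  have "\<exists>s. S s v \<and> \<not> S (Suc s) v"
    using S_0[of v] assms by (induction t) auto
  then obtain s where s: "S s v" "\<not> S (Suc s) v" by blast
  then obtain u where "nrm (u - v) = 1" "S (Suc s) u" using S_step by blast
  then have "\<exists>w. nrm w = 1 \<and> (\<exists>t. \<not> S t v \<and> S t (v + w))"
    using s(2) by (intro exI[of _ "u - v"]) auto
  from someI_ex[OF this] assms show ?thesis by (auto simp: parent_def)
qed

lemma nrm_parent: "nrm (parent S v - v) \<le> 1"
  by (cases "\<forall>t. S t v") (auto simp: parent_bad dest: parent_good)

text \<open>This gives the forest its finite past: below a vertex outside \<open>S t\<close> there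
  are fewer than \<open>t\<close> generations of descendants, because nothing lies outside
  \<open>S 0\<close>.\<close>

lemma child_earlier:
  assumes "parent S u = v" "\<not> S (Suc t) v"
  shows "\<not> S t u"
proof -
  have "\<not> (\<forall>t. S t u)" using assms parent_bad by metis
  then obtain s where s: "\<not> S s u" "S s v" using parent_good assms(1) by blast
  then have "s \<le> t" using S_antimono[of "Suc t" s v] assms(2) by force
  then show ?thesis using s(1) S_antimono by blast
qed

lemma child_not: "parent S u = v \<Longrightarrow> \<not> S t v \<Longrightarrow> \<not> S t u"
  using child_earlier S_Suc by blast

lemma unmatched_at_stable: "\<not> S t v \<Longrightarrow> t \<le> n \<Longrightarrow> unmatched_at S n v = unmatched_at S t v"
proof (induction t arbitrary: v n)
  case 0
  then show ?case using S_0 by simp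
next
  case (Suc t)
  then obtain m where m: "n = Suc m" "t \<le> m" by (cases n) auto
  have "{u. parent S u = v \<and> unmatched_at S m u} = {u. parent S u = v \<and> unmatched_at S t u}"
    using Suc.IH[OF child_earlier[OF _ Suc.prems(1)] m(2)] by blast
  then show ?case by (simp add: m(1))
qed

lemma unmatched_eq: "\<not> S t v \<Longrightarrow> t \<le> n \<Longrightarrow> unmatched S v = unmatched_at S n v"
  using unmatched_at_stable unfolding unmatched_def by (metis nat_le_linear)

lemma unmatched_iff:
  assumes "\<not> S t v"
  shows "unmatched S v \<longleftrightarrow> even (card {u. parent S u = v \<and> unmatched S u})"
proof -
  have "{u. parent S u = v \<and> unmatched S u} = {u. parent S u = v \<and> unmatched_at S t u}"
    using unmatched_eq[OF child_not[OF _ assms] order_refl] by blast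
  then show ?thesis using unmatched_eq[OF assms, of "Suc t"] by simp
qed

lemma nrm_cell: "u \<in> cell S w \<Longrightarrow> nrm (u - w) \<le> 1"
  using nrm_parent[of u] by (auto simp: cell_def nrm_minus_commute)

lemma finite_cell: "finite (cell S w)"
  by (rule finite_subset[OF _ finite_ball_around[of w 1]]) (auto dest: nrm_cell)

text \<open>Either \<open>w\<close> is left over, and its cell is the even set of left over
  children, or their number is odd and \<open>w\<close> completes it.\<close>

lemma even_card_cell:
  assumes "\<not> S t w"
  shows "even (card (cell S w))"
proof -
  have fin: "finite {u. parent S u = w \<and> unmatched S u}"
    by (rule finite_subset[OF _ finite_cell[of w]]) (auto simp: cell_def)
  show ?thesis
  proof (cases "unmatched S w")
    case True
    then have "cell S w = {u. parent S u = w \<and> unmatched S u}" by (auto simp: cell_def)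
    then show ?thesis using unmatched_iff[OF assms] True by simp
  next
    case False
    then have "cell S w = insert w {u. parent S u = w \<and> unmatched S u}" by (auto simp: cell_def)
    then show ?thesis using unmatched_iff[OF assms] False fin by simp
  qed
qed

lemma mem_cell_root: "v \<in> cell S (cell_root S v)"
  by (auto simp: cell_def cell_root_def)

lemma cell_root_eq: "v \<in> cell S w \<Longrightarrow> cell_root S v = w"
  by (auto simp: cell_def cell_root_def)

lemma
  assumes good: "\<And>v. \<exists>t. \<not> S t v"
  shows nrm_partner: "nrm (partner S v - v) \<le> 2"
    and partner_neq: "partner S v \<noteq> v"
    and partner_partner: "partner S (partner S v) = v"
proof -
  define w where "w = cell_root S v"
  define A where "A = {u. w + u \<in> cell S w}"
  have A: "A = (\<lambda>u. u - w) ` cell S w"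
  proof (rule set_eqI)
    fix u show "u \<in> A \<longleftrightarrow> u \<in> (\<lambda>u. u - w) ` cell S w"
      unfolding A_def by (force simp: image_iff intro: bexI[of _ "w + u"])
  qed
  have fin: "finite A" unfolding A using finite_cell by simp
  have "card A = card (cell S w)" unfolding A by (rule card_image) (auto simp: inj_on_def)
  then have ev: "even (card A)" using even_card_cell good by metis
  have v: "v - w \<in> A" using mem_cell_root[of v] by (simp add: A_def w_def)
  have p: "partner S v = w + pairing A (v - w)"
    by (simp add: partner_def Let_def w_def A_def)
  have pc: "partner S v \<in> cell S w"
    using pairing_mem[OF fin ev v] by (simp add: p A_def)
  show "partner S v \<noteq> v" using pairing_neq[OF fin ev v] by (metis p add_diff_cancel_left')
  have "partner S (partner S v) = w + pairing A (partner S v - w)"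
    using cell_root_eq[OF pc] by (simp add: partner_def[of S "partner S v"] Let_def A_def)
  then show "partner S (partner S v) = v"
    using pairing_pairing[OF fin ev v] by (simp add: p)
  show "nrm (partner S v - v) \<le> 2"
    using nrm_cell[OF pc] nrm_cell[OF mem_cell_root[of v]] nrm_triangle_diff[of "partner S v" v w]
    by (simp add: w_def nrm_minus_commute)
qed

lemma PM_valid_partner:
  assumes "\<And>v. \<exists>t. \<not> S t v"
  shows "PM_valid (\<lambda>v. partner S v - v)"
  unfolding PM_valid_iff_local
proof
  fix v
  have "(\<Sum>i\<in>UNIV. \<bar>(partner S v - v) $ i\<bar>) \<le> 2"
    using nrm_partner[OF assms, of v] int_nrm[of "partner S v - v"] by linarith
  then have "partner S v - v \<in> PM_labels"
    using partner_neq[OF assms, of v] by (auto simp: PM_labels_def boxtimes_adj_def)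
  then show "partner S v - v \<in> PM_labels \<and>
      partner S (v + (partner S v - v)) - (v + (partner S v - v)) = - (partner S v - v)"
    by (simp add: partner_partner[OF assms])
qed

end

section \<open>Locality of the matching\<close>

locale filtration_shift = S: filtration S + S': filtration S'
  for S S' :: "nat \<Rightarrow> 'd::finite vertex \<Rightarrow> bool" +
  fixes a :: "'d vertex" and t r :: nat
  assumes agree: "s \<le> t \<Longrightarrow> nrm v \<le> r \<Longrightarrow> S' s v = S s (a + v)"
begin

lemma parent_shift:
  assumes v: "nrm v + 1 \<le> r" and nS: "\<not> S' t v"
  shows "a + parent S' v = parent S (a + v)"
proof -
  have nS': "\<not> S t (a + v)" using agree[of t v] v nS by simp
  have "(\<exists>s. \<not> S' s v \<and> S' s (v + w)) \<longleftrightarrow> (\<exists>s. \<not> S s (a + v) \<and> S s (a + v + w))"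
    if w: "nrm w = 1" for w
  proof -
    have vw: "nrm (v + w) \<le> r" using v w nrm_triangle[of v w] by linarith
    have iff: "\<not> S' s v \<and> S' s (v + w) \<longleftrightarrow> \<not> S s (a + v) \<and> S s (a + v + w)" if "s \<le> t" for s
      using agree[OF that, of v] agree[OF that vw] v by (simp add: add.assoc)
    \<comment> \<open>Witnesses later than \<open>t\<close> can be replaced by \<open>t\<close>
      itself: \<open>v\<close> has already left by then, and a neighbour that is present later is
      present at time \<open>t\<close>.\<close>
    have "\<exists>s\<le>t. \<not> S' s v \<and> S' s (v + w)" if "\<not> S' s v \<and> S' s (v + w)" for s
      using that nS S'.S_antimono[of t s "v + w"]
      by (cases "s \<le> t") (auto intro: exI[of _ s] exI[of _ t])
    moreover have "\<exists>s\<le>t. \<not> S s (a + v) \<and> S s (a + v + w)" if "\<not> S s (a + v) \<and> S s (a + v + w)" for s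
      using that nS' S.S_antimono[of t s "a + v + w"]
      by (cases "s \<le> t") (auto intro: exI[of _ s] exI[of _ t])
    ultimately show ?thesis using iff by blast
  qed
  then have "(\<lambda>w. nrm w = 1 \<and> (\<exists>s. \<not> S' s v \<and> S' s (v + w))) =
      (\<lambda>w. nrm w = 1 \<and> (\<exists>s. \<not> S s (a + v) \<and> S s (a + v + w)))"
    by (intro ext conj_cong refl)
  moreover have "\<not> (\<forall>t. S' t v)" "\<not> (\<forall>t. S t (a + v))" using nS nS' by blast+
  ultimately show ?thesis unfolding parent_def by (simp only: if_False add.assoc)
qed

lemma children_shift:
  assumes v: "nrm v + 2 \<le> r" and nS: "\<not> S' t v"
    and P: "\<And>u. parent S' u = v \<Longrightarrow> nrm u \<le> nrm v + 1 \<Longrightarrow> \<not> S' t u \<Longrightarrow> P' u \<longleftrightarrow> P (a + u)"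
  shows "{u. parent S u = a + v \<and> P u} = (+) a ` {u. parent S' u = v \<and> P' u}"
proof -
  have nS': "\<not> S t (a + v)" using agree[of t v] v nS by simp
  have le: "nrm u \<le> nrm v + 1" if "nrm (v - u) \<le> 1" for u
    using that nrm_le_add_diff[of u v] by (simp add: nrm_minus_commute)
  have "parent S (a + u) = a + v \<and> P (a + u)" if "parent S' u = v" "P' u" for u
  proof -
    have "\<not> S' t u" by (rule S'.child_not[OF that(1) nS])
    moreover have "nrm u \<le> nrm v + 1" using S'.nrm_parent[of u] that by (intro le) simp
    ultimately show ?thesis using parent_shift[of u] P that v by auto
  qed
  moreover have *: "parent S' u = v \<and> P' u" if "parent S (a + u) = a + v" "P (a + u)" for u
  proof -
    have u: "nrm u \<le> nrm v + 1" using S.nrm_parent[of "a + u"] that by (intro le) simp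
    have "\<not> S t (a + u)" by (rule S.child_not[OF that(1) nS'])
    then have "\<not> S' t u" using agree[of t u] u v by simp
    then show ?thesis using parent_shift[of u] P[of u] that v u by auto
  qed
  ultimately show ?thesis
  proof (intro set_eqI iffI)
    fix x assume "x \<in> {u. parent S u = a + v \<and> P u}"
    then show "x \<in> (+) a ` {u. parent S' u = v \<and> P' u}"
      using *[of "x - a"] by (intro image_eqI[of _ _ "x - a"]) auto
  qed auto
qed

lemma unmatched_at_shift:
  assumes "nrm v + n + 1 \<le> r" "\<not> S' t v"
  shows "unmatched_at S' n v \<longleftrightarrow> unmatched_at S n (a + v)"
  using assms
proof (induction n arbitrary: v)
  case (Suc n)
  have "{u. parent S u = a + v \<and> unmatched_at S n u} = (+) a ` {u. parent S' u = v \<and> unmatched_at S' n u}"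
    by (rule children_shift) (use Suc in auto)
  then show ?case by (simp add: card_image)
qed simp

lemma unmatched_shift:
  assumes "nrm v + t + 1 \<le> r" "\<not> S' t v"
  shows "unmatched S' v \<longleftrightarrow> unmatched S (a + v)"
proof -
  have "\<not> S t (a + v)" using agree[of t v] assms by simp
  then show ?thesis
    using unmatched_at_shift[OF assms] S.unmatched_eq[OF _ order_refl]
      S'.unmatched_eq[OF assms(2) order_refl] by simp
qed

lemma cell_shift:
  assumes v: "nrm v + t + 2 \<le> r" and nS: "\<not> S' t v"
  shows "cell S (a + v) = (+) a ` cell S' v"
proof -
  have "{u. parent S u = a + v \<and> unmatched S u} = (+) a ` {u. parent S' u = v \<and> unmatched S' u}"
    by (rule children_shift) (use v nS unmatched_shift in auto)
  moreover have "{u. u = a + v \<and> \<not> unmatched S u} = (+) a ` {u. u = v \<and> \<not> unmatched S' u}"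
    using unmatched_shift[of v] v nS by auto
  ultimately show ?thesis by (simp add: cell_def image_Un)
qed

lemma partner_shift:
  assumes r: "t + 3 \<le> r" and nS: "\<And>w. nrm w \<le> 1 \<Longrightarrow> \<not> S' t w"
  shows "partner S a = a + partner S' 0"
proof -
  define w where "w = cell_root S' 0"
  \<comment> \<open>The root of the cell is the vertex itself or its parent. This is why
    \<open>nS\<close> covers the neighbours and why the radius is one more than in
    \<open>cell_shift\<close>.\<close>
  have "nrm w \<le> 1" using S'.nrm_parent[of 0] by (simp add: w_def cell_root_def)
  then have "cell S (a + w) = (+) a ` cell S' w"
    using r by (intro cell_shift nS) auto
  then have cell: "{u. (a + w) + u \<in> cell S (a + w)} = {u. w + u \<in> cell S' w}"
    by (auto simp: add.assoc)
  have root: "cell_root S a = a + w"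
    using parent_shift[of 0] unmatched_shift[of 0] r nS[of 0] by (simp add: w_def cell_root_def)
  have "a - (a + w) = 0 - w" by simp
  then have "partner S a = (a + w) + pairing {u. w + u \<in> cell S' w} (0 - w)"
    unfolding partner_def Let_def root cell by (simp only:)
  also have "\<dots> = a + partner S' 0"
    unfolding partner_def Let_def w_def[symmetric] by (rule add.assoc)
  finally show ?thesis .
qed

end

section \<open>The local algorithm\<close>

lemma filtration_stage: "filtration (stage B)"
  by unfold_locales (fact stage_0 stage_Suc stage_step)+

text \<open>This is \<open>(2 ^ k / spacing k) ^ d\<close>.\<close>

definition intensity :: "nat \<Rightarrow> nat \<Rightarrow> real" where
  "intensity d k = (1 / 2) ^ (d * (k * k - k))"

text \<open>All levels are read off from the same label and are thus dependent. This is harmless,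
  because the density bound for a net only involves the marks of its own level, the lower levels
  entering through the deterministic bound on the size of links.\<close>

definition marks :: "('d::finite vertex \<Rightarrow> real) \<Rightarrow> 'd config" where
  "marks \<omega> k v \<longleftrightarrow> \<omega> v < intensity CARD('d) k"

definition exposed :: "'d::finite config \<Rightarrow> nat \<Rightarrow> 'd vertex \<Rightarrow> bool" where
  "exposed B m v \<longleftrightarrow> (\<exists>w. nrm w \<le> 1 \<and> net B m (v + w))"

text \<open>Covers the \<open>start m + 3\<close> steps of the matching, together with the range
  \<open>start (Suc m) + net_range (Suc m)\<close> needed to decide the stages.\<close>

definition radius :: "nat \<Rightarrow> nat" where
  "radius m = 15 * len (Suc m)"

lemma net_range_le_radius: "net_range m + 1 \<le> radius m"
  using net_range_le[of m] len_Suc_ge[of m] spacing_le_len[of m] spacing_pos[of m]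
  unfolding radius_def by linarith

lemma exposed_looks_like:
  assumes "looks_like (Suc m) (radius m) a B' B"
  shows "exposed B' m 0 \<longleftrightarrow> exposed B m a"
proof -
  have "net B' m w \<longleftrightarrow> net B m (a + w)" if "nrm w \<le> 1" for w
    by (rule net_looks_like[OF looks_like_mono[OF assms]])
      (use that net_range_le_radius[of m] in auto)
  then show ?thesis by (auto simp: exposed_def)
qed

text \<open>If the origin is not exposed, then it and its neighbours have left the stages by time
  \<open>start m\<close>, so their descendants, and with them the cell, can be computed inside the
  ball.\<close>

lemma partner_looks_like:
  assumes ll: "looks_like (Suc m) (radius m) a B' B" and ex: "\<not> exposed B' m 0"
  shows "partner (stage B) a = a + partner (stage B') 0"
proof -
  interpret S: filtration "stage B" by (rule filtration_stage)
  interpret S': filtration "stage B'" by (rule filtration_stage)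
  have r: "start m + 3 + start (Suc m) + net_range (Suc m) \<le> radius m"
    using start_le_len[of m] start_le_len[of "Suc m"] net_range_le[of "Suc m"] len_Suc_ge[of m]
      spacing_le_len[of m] spacing_pos[of m] unfolding radius_def by linarith
  interpret filtration_shift "stage B" "stage B'" a "start m" "start m + 3"
    by unfold_locales (use r in \<open>auto intro!: stage_looks_like[OF ll] simp del: start.simps net_range.simps\<close>)
  show ?thesis
    by (rule partner_shift) (use ex stage_start_net in \<open>auto simp: exposed_def\<close>)
qed

text \<open>A set that depends on finitely many measurable bits is a finite union of atoms. This
  gives measurability without analysing how the choices inside the construction depend on the
  labels.\<close>

lemma finite_bits_sets:
  assumes "finite K" "\<And>i. i \<in> K \<Longrightarrow> {x \<in> space M. b i x} \<in> sets M"
    and "A \<subseteq> space M"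
    and dep: "\<And>x y. x \<in> space M \<Longrightarrow> y \<in> space M \<Longrightarrow> (\<And>i. i \<in> K \<Longrightarrow> b i x = b i y) \<Longrightarrow> x \<in> A \<Longrightarrow> y \<in> A"
  shows "A \<in> sets M"
proof -
  define \<sigma> where "\<sigma> x = {i \<in> K. b i x}" for x
  have "A = (\<Union>s\<in>\<sigma> ` A. {x \<in> space M. \<forall>i\<in>K. b i x = (i \<in> s)})"
  proof (intro set_eqI iffI)
    fix x assume "x \<in> A"
    then show "x \<in> (\<Union>s\<in>\<sigma> ` A. {x \<in> space M. \<forall>i\<in>K. b i x = (i \<in> s)})"
      using assms(3) by (intro UN_I[of "\<sigma> x"]) (auto simp: \<sigma>_def)
  next
    fix y assume "y \<in> (\<Union>s\<in>\<sigma> ` A. {x \<in> space M. \<forall>i\<in>K. b i x = (i \<in> s)})"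
    then obtain x where x: "x \<in> A" "y \<in> space M" "\<forall>i\<in>K. b i y = (i \<in> \<sigma> x)" by blast
    show "y \<in> A"
      by (rule dep[of x y]) (use x assms(3) in \<open>auto simp: \<sigma>_def\<close>)
  qed
  moreover have "{x \<in> space M. \<forall>i\<in>K. b i x = (i \<in> s)} \<in> sets M" for s
  proof (rule sets.sets_Collect_finite_All[OF _ assms(1)])
    fix i assume "i \<in> K"
    then show "{x \<in> space M. b i x = (i \<in> s)} \<in> sets M"
      using assms(2) sets.sets_Collect_neg[of M "b i"] by (cases "i \<in> s") auto
  qed
  moreover have "finite (\<sigma> ` A)"
    by (rule finite_subset[of _ "Pow K"]) (auto simp: \<sigma>_def assms(1))
  ultimately show ?thesis by (metis (no_types, lifting) sets.finite_UN)
qed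

lemma space_unif01: "space unif01 = {0..1}"
  by (simp add: unif01_def space_restrict_space)

lemma sets_unif01: "A \<in> sets lborel \<Longrightarrow> A \<subseteq> {0..1} \<Longrightarrow> A \<in> sets unif01"
  unfolding unif01_def by (subst sets_restrict_space_iff) auto

lemma sets_mark_PiM:
  assumes "v \<in> I"
  shows "{x \<in> space (PiM I (\<lambda>_. unif01)). (x v :: real) < c} \<in> sets (PiM I (\<lambda>_. unif01))"
proof -
  have "{0..1} \<inter> {..<c} \<in> sets unif01" by (rule sets_unif01) simp_all
  moreover have "{y \<in> space unif01. y < c} = {0..1} \<inter> {..<c}" by (auto simp: space_unif01)
  ultimately have "{y \<in> space unif01. y < c} \<in> sets unif01" by (simp only:)
  from measurable_sets[OF measurable_component_singleton[OF assms] this]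
  show ?thesis by (rule back_subst[of "\<lambda>A. A \<in> _"]) (use assms in \<open>auto simp: space_PiM\<close>)
qed

lemma finite_marks_sets:
  assumes "finite V" "V \<subseteq> I" "A \<subseteq> space (PiM I (\<lambda>_. unif01))"
    and dep: "\<And>x y. x \<in> space (PiM I (\<lambda>_. unif01)) \<Longrightarrow> y \<in> space (PiM I (\<lambda>_. unif01)) \<Longrightarrow>
      (\<And>j v. j \<le> k \<Longrightarrow> v \<in> V \<Longrightarrow> marks x j v = marks y j v) \<Longrightarrow> x \<in> A \<Longrightarrow> y \<in> A"
  shows "A \<in> sets (PiM I (\<lambda>_. unif01))"
proof (rule finite_bits_sets[where K = "{..k} \<times> V" and b = "\<lambda>(j, v) x. marks x j v"])
  fix i assume "i \<in> {..k} \<times> V"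
  then show "{x \<in> space (PiM I (\<lambda>_. unif01)). (case i of (j, v) \<Rightarrow> \<lambda>x. marks x j v) x} \<in> sets (PiM I (\<lambda>_. unif01))"
    using assms(2) by (auto simp: marks_def intro!: sets_mark_PiM)
next
  fix x y
  assume x: "x \<in> space (PiM I (\<lambda>_. unif01))" and y: "y \<in> space (PiM I (\<lambda>_. unif01))"
    and b: "\<And>i. i \<in> {..k} \<times> V \<Longrightarrow> (case i of (j, v) \<Rightarrow> \<lambda>x. marks x j v) x = (case i of (j, v) \<Rightarrow> \<lambda>x. marks x j v) y"
    and A: "x \<in> A"
  show "y \<in> A"
    by (rule dep[OF x y _ A]) (use b in force)
qed (use assms in auto)

section \<open>Stopping rule and output\<close>

definition halting :: "'d::finite nbhd set" where
  "halting = {(r, x). x \<in> space (nbhd_space r) \<and> (\<exists>m. r = radius m \<and> \<not> exposed (marks x) m 0)}"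

text \<open>The default value only serves to keep the output inside \<^const>\<open>PM_labels\<close> on every neighbourhood.\<close>

definition label_of :: "'d::finite vertex \<Rightarrow> 'd vertex" where
  "label_of w = (if w \<in> PM_labels then w else axis undefined 1)"

definition outcome :: "'d::finite nbhd \<Rightarrow> 'd vertex" where
  "outcome = (\<lambda>(r, x). label_of (partner (stage (marks x)) 0))"

lemma label_of_mem: "label_of w \<in> PM_labels"
proof -
  have "axis undefined 1 \<noteq> (0 :: 'a vertex)" by (simp add: vec_eq_iff axis_def)
  moreover have "(\<Sum>i\<in>UNIV. \<bar>axis undefined 1 $ i\<bar>) \<le> (2::int)"
    by (subst int_nrm[symmetric]) simp
  ultimately show ?thesis by (auto simp: label_of_def PM_labels_def boxtimes_adj_def)
qed

lemma finite_PM_labels: "finite (PM_labels :: 'd::finite vertex set)"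
proof (rule finite_subset[OF _ finite_ball[of 2]])
  show "PM_labels \<subseteq> {v :: 'd vertex. nrm v \<le> 2}"
    by (auto simp: PM_labels_def boxtimes_adj_def nrm_def)
qed

lemma halting_outcome_measurable:
  "{x \<in> space (nbhd_space r). (r, x) \<in> halting \<and> outcome (r, x) \<in> Y} \<in> sets (nbhd_space r)"
proof -
  let ?A = "\<lambda>m. {x \<in> space (nbhd_space r). \<not> exposed (marks x) m 0 \<and> outcome (r, x) \<in> Y}"
  have A: "?A m \<in> sets (nbhd_space r)" if m: "r = radius m" for m
    unfolding nbhd_space_def
  proof (rule finite_marks_sets[where V = "grid_ball r" and k = "Suc m"])
    fix x y :: "'a vertex \<Rightarrow> real"
    assume "\<And>j v. j \<le> Suc m \<Longrightarrow> v \<in> grid_ball r \<Longrightarrow> marks x j v = marks y j v"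
      and y: "y \<in> space (\<Pi>\<^sub>M i\<in>grid_ball r. unif01)"
      and x: "x \<in> {x \<in> space (\<Pi>\<^sub>M i\<in>grid_ball r. unif01). \<not> exposed (marks x) m 0 \<and> outcome (r, x) \<in> Y}"
    then have ll: "looks_like (Suc m) (radius m) 0 (marks x) (marks y)"
      by (auto simp: looks_like_def grid_ball_eq m)
    show "y \<in> {x \<in> space (\<Pi>\<^sub>M i\<in>grid_ball r. unif01). \<not> exposed (marks x) m 0 \<and> outcome (r, x) \<in> Y}"
      using x y exposed_looks_like[OF ll] partner_looks_like[OF ll] by (auto simp: outcome_def)
  qed (auto simp: grid_ball_eq)
  have "{x \<in> space (nbhd_space r). (r, x) \<in> halting \<and> outcome (r, x) \<in> Y} = (\<Union>m\<in>{m. r = radius m}. ?A m)"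
    by (auto simp: halting_def)
  also have "\<dots> \<in> sets (nbhd_space r)"
    using A by (intro sets.countable_UN'') auto
  finally show ?thesis .
qed

lemma uniform_local_algorithm_halting: "uniform_local_algorithm PM_labels halting outcome"
  unfolding uniform_local_algorithm_def
proof (intro conjI allI)
  fix r
  have "{x. (r, x) \<in> halting} = {x \<in> space (nbhd_space r). (r, x) \<in> halting \<and> outcome (r, x) \<in> UNIV}"
    by (auto simp: halting_def)
  also have "\<dots> \<in> sets (nbhd_space r)" by (rule halting_outcome_measurable)
  finally show H: "{x. (r, x) \<in> halting} \<in> sets (nbhd_space r)" .
  show "(\<lambda>x. outcome (r, x)) \<in> restrict_space (nbhd_space r) {x. (r, x) \<in> halting} \<rightarrow>\<^sub>M count_space PM_labels"
  proof (rule measurableI)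
    fix Y
    let ?R = "restrict_space (nbhd_space r) {x. (r, x) \<in> halting}"
    have "(\<lambda>x. outcome (r, x)) -` Y \<inter> space ?R =
        {x \<in> space (nbhd_space r). (r, x) \<in> halting \<and> outcome (r, x) \<in> Y}"
      by (auto simp: space_restrict_space)
    moreover have "\<dots> \<in> sets ?R"
    proof (subst sets_restrict_space_iff)
      show "{x. (r, x) \<in> halting} \<inter> space (nbhd_space r) \<in> sets (nbhd_space r)"
        using H by (rule sets.Int) simp
    qed (use halting_outcome_measurable in auto)
    ultimately show "(\<lambda>x. outcome (r, x)) -` Y \<inter> space ?R \<in> sets ?R" by simp
  qed (auto simp: outcome_def label_of_mem)
qed (rule finite_PM_labels)

lemma view_mem:
  assumes "\<omega> \<in> space label_space"
  shows "snd (view \<omega> u r) \<in> space (nbhd_space r)"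
  using assms by (auto simp: view_def label_space_def nbhd_space_def space_PiM)

lemma looks_like_view: "looks_like k r u (marks (snd (view \<omega> u r))) (marks \<omega>)"
  by (auto simp: looks_like_def view_def marks_def grid_ball_eq)

lemma view_halting_iff:
  assumes "\<omega> \<in> space label_space"
  shows "view \<omega> u r \<in> halting \<longleftrightarrow> (\<exists>m. r = radius m \<and> \<not> exposed (marks \<omega>) m u)"
proof -
  have "view \<omega> u r = (r, snd (view \<omega> u r))" by (simp add: view_def)
  then have "view \<omega> u r \<in> halting \<longleftrightarrow>
      (\<exists>m. r = radius m \<and> \<not> exposed (marks (snd (view \<omega> u r))) m 0)"
    using view_mem[OF assms, of u r] by (auto simp: halting_def)
  then show ?thesis using exposed_looks_like[OF looks_like_view] by auto
qed

lemma coding_radius_le: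
  assumes "\<omega> \<in> space label_space" "\<not> exposed (marks \<omega>) m u"
  shows "coding_radius halting \<omega> u \<le> enat (radius m)"
  unfolding coding_radius_def
  by (rule Inf_lower) (use assms view_halting_iff in auto)

lemma run_halting:
  assumes \<omega>: "\<omega> \<in> space label_space" and "\<not> exposed (marks \<omega>) m u"
  shows "run halting outcome \<omega> u = label_of (partner (stage (marks \<omega>)) u - u)"
proof -
  let ?R = "{enat r |r. view \<omega> u r \<in> halting}"
  have "enat (radius m) \<in> ?R" using assms view_halting_iff by auto
  then have "coding_radius halting \<omega> u \<in> ?R"
    unfolding coding_radius_def Inf_enat_def by (metis (no_types, lifting) LeastI empty_iff)
  then obtain r where r: "coding_radius halting \<omega> u = enat r" "view \<omega> u r \<in> halting" by blast
  then obtain n where n: "r = radius n" "\<not> exposed (marks \<omega>) n u"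
    using view_halting_iff[OF \<omega>] by blast
  let ?x = "snd (view \<omega> u r)"
  have ll: "looks_like (Suc n) (radius n) u (marks ?x) (marks \<omega>)"
    unfolding n(1) by (rule looks_like_view)
  have "partner (stage (marks \<omega>)) u = u + partner (stage (marks ?x)) 0"
    using partner_looks_like[OF ll] exposed_looks_like[OF ll] n(2) by blast
  moreover have "run halting outcome \<omega> u = outcome (r, ?x)"
    by (simp add: run_def r(1) view_def)
  ultimately show ?thesis by (simp add: outcome_def)
qed

lemma PM_valid_run_halting:
  assumes \<omega>: "\<omega> \<in> space label_space" and ex: "\<And>u. \<exists>m. \<not> exposed (marks \<omega>) m u"
  shows "PM_valid (run halting outcome \<omega>)"
proof -
  interpret filtration "stage (marks \<omega>)" by (rule filtration_stage)
  have "\<exists>t. \<not> stage (marks \<omega>) t u" for u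
  proof -
    obtain m where "\<not> exposed (marks \<omega>) m u" using ex by blast
    then have "\<not> net (marks \<omega>) m (u + 0)" unfolding exposed_def using nrm_0 by (metis zero_le)
    then show ?thesis using stage_start_net by (metis add.right_neutral)
  qed
  then have v: "PM_valid (\<lambda>u. partner (stage (marks \<omega>)) u - u)" by (rule PM_valid_partner)
  have "run halting outcome \<omega> u = partner (stage (marks \<omega>)) u - u" for u
  proof -
    obtain m where "\<not> exposed (marks \<omega>) m u" using ex by blast
    from run_halting[OF \<omega> this] show ?thesis
      using v unfolding PM_valid_iff_local by (auto simp: label_of_def)
  qed
  then have "run halting outcome \<omega> = (\<lambda>u. partner (stage (marks \<omega>)) u - u)" by (rule ext)
  with v show ?thesis by simp
qed

lemma sets_label_space_marks:
  assumes "A \<subseteq> space label_space"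
    and "\<And>x y. x \<in> space label_space \<Longrightarrow> y \<in> space label_space \<Longrightarrow>
      (\<And>j v. j \<le> k \<Longrightarrow> nrm (v - u) \<le> r \<Longrightarrow> marks x j v = marks y j v) \<Longrightarrow> x \<in> A \<Longrightarrow> y \<in> A"
  shows "A \<in> sets label_space"
  unfolding label_space_def
proof (rule finite_marks_sets[where V = "{v. nrm (v - u) \<le> r}" and k = k])
  show "A \<subseteq> space (\<Pi>\<^sub>M i\<in>UNIV. unif01)" using assms(1) by (simp add: label_space_def)
  show "y \<in> A"
    if "x \<in> space (\<Pi>\<^sub>M i\<in>UNIV. unif01)" "y \<in> space (\<Pi>\<^sub>M i\<in>UNIV. unif01)"
      "\<And>j v. j \<le> k \<Longrightarrow> v \<in> {v. nrm (v - u) \<le> r} \<Longrightarrow> marks x j v = marks y j v" "x \<in> A" for x y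
    by (rule assms(2)[of x y]) (use that in \<open>auto simp: label_space_def\<close>)
qed auto

lemma sets_exposed: "{\<omega> \<in> space label_space. exposed (marks \<omega>) m u} \<in> sets label_space"
proof (rule sets_label_space_marks[where u = u and r = "radius m" and k = "Suc m"])
  fix x y :: "'a vertex \<Rightarrow> real"
  assume "\<And>j v. j \<le> Suc m \<Longrightarrow> nrm (v - u) \<le> radius m \<Longrightarrow> marks x j v = marks y j v"
    and x: "x \<in> {\<omega> \<in> space label_space. exposed (marks \<omega>) m u}" and y: "y \<in> space label_space"
  then have "looks_like (Suc m) (radius m) u (\<lambda>j v. marks x j (u + v)) (marks x)"
    "looks_like (Suc m) (radius m) u (\<lambda>j v. marks x j (u + v)) (marks y)"
    by (auto simp: looks_like_def)
  then show "y \<in> {\<omega> \<in> space label_space. exposed (marks \<omega>) m u}"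
    using x y exposed_looks_like by blast
qed auto

section \<open>Density of the nets\<close>

lemma measure_unif01: "A \<in> sets lborel \<Longrightarrow> A \<subseteq> {0..1} \<Longrightarrow> measure unif01 A = measure lborel A"
  unfolding unif01_def by (rule measure_restrict_space) auto

lemma prob_space_unif01: "prob_space unif01"
proof
  have "emeasure (restrict_space lborel {0..1::real}) {0..1} = emeasure lborel {0..1::real}"
    by (rule emeasure_restrict_space) auto
  then show "emeasure unif01 (space unif01) = 1" unfolding space_unif01 by (simp add: unif01_def)
qed

lemma prob_space_label_space: "prob_space label_space"
  unfolding label_space_def by (intro prob_space_PiM prob_space_unif01)

lemma measure_label_space_box:
  fixes J :: "'d::finite vertex set"
  assumes "finite J" "\<And>i. i \<in> J \<Longrightarrow> A i \<in> sets unif01"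
  shows "measure label_space {\<omega> \<in> space label_space. \<forall>i\<in>J. \<omega> i \<in> A i} = (\<Prod>i\<in>J. measure unif01 (A i))"
proof -
  interpret unif01: prob_space unif01 by (rule prob_space_unif01)
  interpret product_prob_space "\<lambda>_ :: 'd vertex. unif01" UNIV by unfold_locales
  have "emeasure label_space {\<omega> \<in> space label_space. \<forall>i\<in>J. \<omega> i \<in> A i} = (\<Prod>i\<in>J. emeasure unif01 (A i))"
    unfolding label_space_def by (rule emeasure_PiM_Collect) (use assms in auto)
  also have "\<dots> = ennreal (\<Prod>i\<in>J. measure unif01 (A i))"
    by (simp add: unif01.emeasure_eq_measure prod_ennreal)
  finally show ?thesis by (simp add: measure_def prod_nonneg)
qed

section \<open>Translation invariance of the random labels\<close>

definition translate :: "'d::finite vertex \<Rightarrow> ('d vertex \<Rightarrow> real) \<Rightarrow> 'd vertex \<Rightarrow> real" where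
  "translate a \<omega> v = \<omega> (a + v)"

lemma distr_translate: "distr label_space label_space (translate a) = label_space"
  and measurable_translate: "translate a \<in> label_space \<rightarrow>\<^sub>M label_space"
proof -
  have eq: "translate a = (\<lambda>\<omega>. \<lambda>v\<in>UNIV. \<omega> (a + v))" by (auto simp: translate_def fun_eq_iff)
  show "distr label_space label_space (translate a) = label_space"
    unfolding label_space_def eq
    by (rule distr_PiM_reindex) (auto intro: prob_space_unif01 simp: inj_on_def)
  show "translate a \<in> label_space \<rightarrow>\<^sub>M label_space"
    unfolding label_space_def eq by (rule measurable_restrict) (rule measurable_component_singleton, simp)
qed

lemma
  assumes "E \<in> sets label_space"
  shows sets_translate: "{\<omega> \<in> space label_space. translate a \<omega> \<in> E} \<in> sets label_space"
    and measure_translate: "measure label_space {\<omega> \<in> space label_space. translate a \<omega> \<in> E} = measure label_space E"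
proof -
  have eq: "{\<omega> \<in> space label_space. translate a \<omega> \<in> E} = translate a -` E \<inter> space label_space" by auto
  show "{\<omega> \<in> space label_space. translate a \<omega> \<in> E} \<in> sets label_space"
    unfolding eq by (rule measurable_sets[OF measurable_translate assms])
  show "measure label_space {\<omega> \<in> space label_space. translate a \<omega> \<in> E} = measure label_space E"
    unfolding eq by (subst measure_distr[OF measurable_translate assms, symmetric]) (simp add: distr_translate)
qed

lemma translate_space: "\<omega> \<in> space label_space \<Longrightarrow> translate a \<omega> \<in> space label_space"
  by (rule measurable_space[OF measurable_translate])

lemma marks_translate: "marks (translate a \<omega>) j v = marks \<omega> j (a + v)"
  by (simp add: marks_def translate_def)

lemma looks_like_translate: "looks_like k r a (marks (translate a \<omega>)) (marks \<omega>)"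
  by (simp add: looks_like_def marks_translate)

lemma label_space_nth: "\<omega> \<in> space label_space \<Longrightarrow> 0 \<le> \<omega> v \<and> \<omega> v \<le> 1"
  by (auto simp: label_space_def space_PiM space_unif01 PiE_iff)

lemma intensity_pos: "0 < intensity d k" and intensity_le_1: "intensity d k \<le> 1"
  by (simp_all add: intensity_def power_le_one)

section \<open>Probabilities of marks and centers\<close>

lemma prob_marked:
  fixes J :: "'d::finite vertex set"
  assumes "finite J"
  shows "measure label_space {\<omega> \<in> space label_space. \<forall>v\<in>J. marks \<omega> k v} = intensity CARD('d) k ^ card J"
proof -
  let ?q = "intensity CARD('d) k"
  have q: "0 \<le> ?q" "?q \<le> 1" using intensity_pos intensity_le_1 by (auto intro: less_imp_le)
  have sub: "{0..<?q} \<subseteq> {0..1}" using q by auto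
  have "{\<omega> \<in> space label_space. \<forall>v\<in>J. marks \<omega> k v} = {\<omega> \<in> space label_space. \<forall>v\<in>J. \<omega> v \<in> {0..<?q}}"
    using label_space_nth by (auto simp: marks_def)
  moreover have "measure label_space {\<omega> \<in> space label_space. \<forall>v\<in>J. \<omega> v \<in> {0..<?q}} = (\<Prod>v\<in>J. measure unif01 {0..<?q})"
    by (rule measure_label_space_box) (use assms sub in \<open>auto intro: sets_unif01\<close>)
  ultimately show ?thesis using q sub by (simp add: measure_unif01)
qed

lemma prob_unmarked:
  fixes J :: "'d::finite vertex set"
  assumes "finite J"
  shows "measure label_space {\<omega> \<in> space label_space. \<forall>v\<in>J. \<not> marks \<omega> k v} = (1 - intensity CARD('d) k) ^ card J"
proof -
  let ?q = "intensity CARD('d) k"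
  have q: "0 \<le> ?q" "?q \<le> 1" using intensity_pos intensity_le_1 by (auto intro: less_imp_le)
  have sub: "{?q..1} \<subseteq> {0..1}" using q by auto
  have "{\<omega> \<in> space label_space. \<forall>v\<in>J. \<not> marks \<omega> k v} = {\<omega> \<in> space label_space. \<forall>v\<in>J. \<omega> v \<in> {?q..1}}"
    using label_space_nth by (auto simp: marks_def not_less)
  moreover have "measure label_space {\<omega> \<in> space label_space. \<forall>v\<in>J. \<omega> v \<in> {?q..1}} = (\<Prod>v\<in>J. measure unif01 {?q..1})"
    by (rule measure_label_space_box) (use assms sub in \<open>auto intro: sets_unif01\<close>)
  ultimately show ?thesis using q sub by (simp add: measure_unif01)
qed

text \<open>The probability that no marked vertex lies within \<open>spacing k\<close> of a given
  vertex, which is then a center for lack of others.\<close>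

definition isolation :: "'d::finite itself \<Rightarrow> nat \<Rightarrow> real" where
  "isolation _ k = (1 - intensity CARD('d) k) ^ card {v :: 'd vertex. nrm v \<le> spacing k}"

lemma sets_marks_all: "finite J \<Longrightarrow> {\<omega> \<in> space label_space. \<forall>v\<in>J. marks \<omega> k v} \<in> sets label_space"
  and sets_unmarked_all: "finite J \<Longrightarrow> {\<omega> \<in> space label_space. \<forall>v\<in>J. \<not> marks \<omega> k v} \<in> sets label_space"
  unfolding label_space_def
  by (auto intro!: finite_marks_sets[where V = J and k = k])

text \<open>Union bound: either all of \<open>J\<close> is marked, or some vertex of
  \<open>J\<close> is isolated.\<close>

lemma prob_center_le:
  fixes J :: "'d::finite vertex set"
  assumes "finite J"
  shows "measure label_space {\<omega> \<in> space label_space. \<forall>v\<in>J. center (spacing k) (marks \<omega> k) v}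
    \<le> intensity CARD('d) k ^ card J + real (card J) * isolation TYPE('d) k"
proof -
  interpret prob_space "label_space :: ('d vertex \<Rightarrow> real) measure" by (rule prob_space_label_space)
  let ?b = "\<lambda>v :: 'd vertex. (+) v ` {w. nrm w \<le> spacing k}"
  let ?M = "{\<omega> \<in> space label_space. \<forall>v\<in>J. marks \<omega> k v}"
  let ?U = "\<lambda>v. {\<omega> \<in> space label_space. \<forall>w\<in>?b v. \<not> marks \<omega> k w}"
  have U: "prob (?U v) = isolation TYPE('d) k" for v
    by (subst prob_unmarked) (auto simp: isolation_def card_image)
  have sU: "?U v \<in> events" for v by (rule sets_unmarked_all) simp
  have sM: "?M \<in> events" by (rule sets_marks_all) fact
  have "{\<omega> \<in> space label_space. \<forall>v\<in>J. center (spacing k) (marks \<omega> k) v} \<subseteq> ?M \<union> (\<Union>v\<in>J. ?U v)"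
    by (auto simp: center_def)
  then have "prob {\<omega> \<in> space label_space. \<forall>v\<in>J. center (spacing k) (marks \<omega> k) v} \<le> prob (?M \<union> (\<Union>v\<in>J. ?U v))"
    by (rule finite_measure_mono) (intro sets.Un sets.finite_UN sM sU assms)
  also have "\<dots> \<le> prob ?M + prob (\<Union>v\<in>J. ?U v)"
    by (intro measure_Un_le sets.finite_UN sM sU assms)
  also have "prob (\<Union>v\<in>J. ?U v) \<le> (\<Sum>v\<in>J. prob (?U v))"
    by (intro measure_UNION_le assms sU)
  finally show ?thesis unfolding prob_marked[OF assms] U by simp
qed

text \<open>The sum is the expected number of events \<open>E w\<close> that occur, and this number
  is at most \<open>n\<close> on \<open>F\<close> and 0 elsewhere.\<close>

lemma (in prob_space) sum_prob_le_card:
  assumes "finite W" "\<And>w. w \<in> W \<Longrightarrow> E w \<in> events" "F \<in> events" "\<And>w. w \<in> W \<Longrightarrow> E w \<subseteq> F"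
    and "\<And>\<omega>. \<omega> \<in> F \<Longrightarrow> card {w \<in> W. \<omega> \<in> E w} \<le> n"
  shows "(\<Sum>w\<in>W. prob (E w)) \<le> real n * prob F"
proof -
  have int: "integrable M (indicat_real A)" if "A \<in> events" for A
    using that by (intro integrable_real_indicator) (auto simp: emeasure_eq_measure)
  have "(\<Sum>w\<in>W. prob (E w)) = (\<Sum>w\<in>W. \<integral>\<omega>. indicat_real (E w) \<omega> \<partial>M)"
    using assms(2) by (intro sum.cong) (auto simp: sets.Int_space_eq2)
  also have "\<dots> = (\<integral>\<omega>. (\<Sum>w\<in>W. indicat_real (E w) \<omega>) \<partial>M)"
    by (rule Bochner_Integration.integral_sum[symmetric]) (use assms(2) int in auto)
  also have "\<dots> \<le> (\<integral>\<omega>. real n * indicat_real F \<omega> \<partial>M)"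
  proof (rule integral_mono)
    fix \<omega>
    have "(\<Sum>w\<in>W. indicat_real (E w) \<omega>) = real (card {w \<in> W. \<omega> \<in> E w})"
      using assms(1) by (simp add: indicator_def sum.If_cases Int_def)
    also have "\<dots> \<le> real n * indicat_real F \<omega>"
    proof (cases "\<omega> \<in> F")
      case False
      then have "{w \<in> W. \<omega> \<in> E w} = {}" using assms(4) by auto
      then have "card {w \<in> W. \<omega> \<in> E w} = 0" by (simp only: card.empty)
      then show ?thesis using False by simp
    qed (use assms(5) in simp)
    finally show "(\<Sum>w\<in>W. indicat_real (E w) \<omega>) \<le> real n * indicat_real F \<omega>" .
  qed (use assms(2,3) int in \<open>auto intro!: integrable_sum\<close>)
  also have "\<dots> = real n * prob F" using assms(3) by (simp add: sets.Int_space_eq2)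
  finally show ?thesis .
qed

text \<open>
  Mass transport: the origin lies on the link from \<open>x\<close> to \<open>x + z\<close> exactly if, seen from \<open>x\<close>, the vertex
  \<open>-x\<close> lies on the link from \<open>0\<close> to \<open>z\<close>; summed over \<open>x\<close>, this counts the vertices of the latter.
\<close>

lemma prob_net_le_sum:
  fixes k :: nat
  defines "c \<equiv> spacing (Suc k)"
  shows "measure label_space {\<omega> \<in> space label_space. net (marks \<omega>) (Suc k) (0 :: 'd::finite vertex)}
    \<le> (\<Sum>z | nrm z \<le> 3 * c. real (len (Suc k) + 1) *
        measure label_space {\<omega> \<in> space label_space. \<forall>v\<in>{0, z :: 'd vertex}. center c (marks \<omega> (Suc k)) v})"
proof -
  interpret prob_space "label_space :: ('d vertex \<Rightarrow> real) measure" by (rule prob_space_label_space)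
  define F where "F z = {\<omega> \<in> space label_space. \<forall>v\<in>{0, z :: 'd vertex}. center c (marks \<omega> (Suc k)) v}" for z
  define A where "A \<omega> x z = rel_link (net (marks \<omega>) k) (anchor (marks \<omega>) k) (len (Suc k)) x z"
    for \<omega> and x z :: "'d vertex"
  define E where "E z w = {\<omega> \<in> F z. w \<in> A \<omega> 0 z}" for z w
  let ?Z = "{z :: 'd vertex. nrm z \<le> 3 * c}" and ?W = "{w :: 'd vertex. nrm w \<le> 2 * len (Suc k)}"
  define r where "r = net_range k + 2 * len (Suc k) + 4 * c"
  have center_eq: "center c (B' (Suc k)) v = center c (B (Suc k)) v"
    if "looks_like (Suc k) r 0 B' B" "nrm v \<le> 3 * c" for v and B' B :: "'d config"
    using center_shift[of v c "B' (Suc k)" "B (Suc k)" 0]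
      looks_like_near[OF that(1), of v c] that(2) by (auto simp: r_def)
  have ll: "looks_like (Suc k) r 0 (marks x) (marks y)"
    if "\<And>j v :: 'd vertex. j \<le> Suc k \<Longrightarrow> nrm (v - 0) \<le> r \<Longrightarrow> marks x j v = marks y j v" for x y
    using that by (auto simp: looks_like_def)
  have sF: "F z \<in> events" if z: "nrm z \<le> 3 * c" for z
  proof (rule sets_label_space_marks[where u = 0 and r = r and k = "Suc k"])
    fix x y :: "'d vertex \<Rightarrow> real"
    assume *: "\<And>j v. j \<le> Suc k \<Longrightarrow> nrm (v - 0) \<le> r \<Longrightarrow> marks x j v = marks y j v"
      and xy: "x \<in> F z" "y \<in> space label_space"
    show "y \<in> F z" using xy center_eq[OF ll[OF *]] z by (simp add: F_def)
  qed (auto simp: F_def)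
  have sE: "E z w \<in> events" if z: "nrm z \<le> 3 * c" for z w
  proof (rule sets_label_space_marks[where u = 0 and r = r and k = "Suc k"])
    fix x y :: "'d vertex \<Rightarrow> real"
    assume *: "\<And>j v. j \<le> Suc k \<Longrightarrow> nrm (v - 0) \<le> r \<Longrightarrow> marks x j v = marks y j v"
      and xy: "x \<in> E z w" "y \<in> space label_space"
    have llk: "looks_like k r 0 (marks x) (marks y)" by (rule looks_like_mono[OF ll[OF *]]) auto
    have "A x 0 z = A y (0 + 0) z"
      unfolding A_def by (rule rel_link_looks_like[OF llk]) (use z in \<open>auto simp: r_def c_def\<close>)
    then show "y \<in> E z w" using xy center_eq[OF ll[OF *]] z by (simp add: E_def F_def)
  qed (auto simp: E_def F_def)
  have "{\<omega> \<in> space label_space. net (marks \<omega>) (Suc k) (0 :: 'd vertex)} \<subseteq>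
      (\<Union>z\<in>?Z. \<Union>w\<in>?W. {\<omega> \<in> space label_space. translate (- w) \<omega> \<in> E z w})"
  proof
    fix \<omega> assume "\<omega> \<in> {\<omega> \<in> space label_space. net (marks \<omega>) (Suc k) (0 :: 'd vertex)}"
    then obtain x z where \<omega>: "\<omega> \<in> space label_space" and z: "nrm z \<le> 3 * c"
      and xz: "center c (marks \<omega> (Suc k)) x" "center c (marks \<omega> (Suc k)) (x + z)" "- x \<in> A \<omega> x z"
      by (auto simp: c_def A_def)
    have W: "- x \<in> ?W" using rel_link_near[OF z[unfolded c_def] xz(3)[unfolded A_def]] by simp
    \<comment> \<open>Translating by \<open>x\<close> moves the first endpoint of the link to the
      origin, where the event \<open>E\<close> is stated.\<close>
    have "center c (marks (translate x \<omega>) (Suc k)) v \<longleftrightarrow> center c (marks \<omega> (Suc k)) (x + v)" for v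
      by (rule center_shift) (simp add: marks_translate)
    moreover have "A (translate x \<omega>) 0 z = A \<omega> (x + 0) z"
      unfolding A_def by (rule rel_link_looks_like[OF looks_like_translate order_refl z[unfolded c_def]])
    ultimately have "translate (- (- x)) \<omega> \<in> E z (- x)"
      using xz translate_space[OF \<omega>] by (simp add: E_def F_def)
    then show "\<omega> \<in> (\<Union>z\<in>?Z. \<Union>w\<in>?W. {\<omega> \<in> space label_space. translate (- w) \<omega> \<in> E z w})"
      using \<omega> z W by blast
  qed
  then have "prob {\<omega> \<in> space label_space. net (marks \<omega>) (Suc k) (0 :: 'd vertex)} \<le>
      prob (\<Union>z\<in>?Z. \<Union>w\<in>?W. {\<omega> \<in> space label_space. translate (- w) \<omega> \<in> E z w})"
    using sets_translate[OF sE] by (intro finite_measure_mono sets.finite_UN) auto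
  also have "\<dots> \<le> (\<Sum>z\<in>?Z. prob (\<Union>w\<in>?W. {\<omega> \<in> space label_space. translate (- w) \<omega> \<in> E z w}))"
    using sets_translate[OF sE] by (intro measure_UNION_le sets.finite_UN) auto
  also have "\<dots> \<le> (\<Sum>z\<in>?Z. real (len (Suc k) + 1) * prob (F z))"
  proof (rule sum_mono)
    fix z assume "z \<in> ?Z"
    then have z: "nrm z \<le> 3 * c" by simp
    have "prob (\<Union>w\<in>?W. {\<omega> \<in> space label_space. translate (- w) \<omega> \<in> E z w}) \<le>
        (\<Sum>w\<in>?W. prob {\<omega> \<in> space label_space. translate (- w) \<omega> \<in> E z w})"
      using sets_translate[OF sE[OF z]] by (intro measure_UNION_le) auto
    also have "\<dots> = (\<Sum>w\<in>?W. prob (E z w))"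
      using measure_translate[OF sE[OF z]] by (intro sum.cong) auto
    also have "\<dots> \<le> real (len (Suc k) + 1) * prob (F z)"
    proof (rule sum_prob_le_card)
      fix \<omega> assume "\<omega> \<in> F z"
      then have "card {w \<in> ?W. \<omega> \<in> E z w} \<le> card (A \<omega> 0 z)"
        using finite_rel_link[OF z[unfolded c_def]] by (intro card_mono) (auto simp: A_def E_def)
      also have "\<dots> \<le> len (Suc k) + 1"
        unfolding A_def by (rule card_rel_link[OF z[unfolded c_def]])
      finally show "card {w \<in> ?W. \<omega> \<in> E z w} \<le> len (Suc k) + 1" .
    qed (use sE[OF z] sF[OF z] in \<open>auto simp: E_def\<close>)
    finally show "prob (\<Union>w\<in>?W. {\<omega> \<in> space label_space. translate (- w) \<omega> \<in> E z w}) \<le> real (len (Suc k) + 1) * prob (F z)" .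
  qed
  finally show ?thesis unfolding F_def .
qed

text \<open>The pairs with \<open>z = 0\<close> require a single center and have probability of
  order \<open>q\<close>; all others require two centers and have order \<open>q ^ 2\<close>. The
  hypothesis lets isolated vertices be absorbed into the constants 2 and 3.\<close>

lemma prob_net_le:
  fixes k :: nat
  assumes iso: "isolation TYPE('d::finite) (Suc k) \<le> intensity CARD('d) (Suc k) ^ 2"
  defines "q \<equiv> intensity CARD('d) (Suc k)" and "c \<equiv> spacing (Suc k)"
  shows "measure label_space {\<omega> \<in> space label_space. net (marks \<omega>) (Suc k) (0 :: 'd vertex)}
    \<le> real (len (Suc k) + 1) * (2 * q + real ((6 * c + 1) ^ CARD('d)) * (3 * q ^ 2))"
proof -
  let ?P = "\<lambda>z :: 'd vertex. measure label_space {\<omega> \<in> space label_space. \<forall>v\<in>{0, z}. center c (marks \<omega> (Suc k)) v}"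
  let ?Z = "{z :: 'd vertex. nrm z \<le> 3 * c}"
  have q: "0 \<le> q" "q \<le> 1" unfolding q_def using intensity_pos intensity_le_1 by (auto intro: less_imp_le)
  have "q ^ 2 \<le> q" using q by (simp add: power2_eq_square mult_left_le)
  then have P0: "?P 0 \<le> 2 * q"
    using prob_center_le[of "{0 :: 'd vertex}" "Suc k"] iso by (simp add: q_def c_def)
  have Pz: "?P z \<le> 3 * q ^ 2" if "z \<noteq> 0" for z
    using prob_center_le[of "{0, z}" "Suc k"] iso that
    by (simp add: q_def c_def card_insert_if power2_eq_square)
  have "(\<Sum>z\<in>?Z. ?P z) = ?P 0 + (\<Sum>z\<in>?Z - {0}. ?P z)" by (rule sum.remove) auto
  also have "(\<Sum>z\<in>?Z - {0}. ?P z) \<le> (\<Sum>z\<in>?Z - {0}. 3 * q ^ 2)" by (rule sum_mono) (use Pz in auto)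
  also have "(\<Sum>z\<in>?Z - {0}. 3 * q ^ 2) = real (card (?Z - {0})) * (3 * q ^ 2)" by simp
  also have "\<dots> \<le> real ((6 * c + 1) ^ CARD('d)) * (3 * q ^ 2)"
  proof (intro mult_right_mono)
    have "card (?Z - {0}) \<le> card ?Z" by (rule card_mono) auto
    also have "\<dots> \<le> (6 * c + 1) ^ CARD('d)" using card_ball_le[of "3 * c", where 'd = 'd] by simp
    finally show "real (card (?Z - {0})) \<le> real ((6 * c + 1) ^ CARD('d))" by (rule of_nat_mono)
  qed simp
  finally have "(\<Sum>z\<in>?Z. ?P z) \<le> 2 * q + real ((6 * c + 1) ^ CARD('d)) * (3 * q ^ 2)"
    using P0 by linarith
  then have "real (len (Suc k) + 1) * (\<Sum>z\<in>?Z. ?P z) \<le>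
      real (len (Suc k) + 1) * (2 * q + real ((6 * c + 1) ^ CARD('d)) * (3 * q ^ 2))"
    by (intro mult_left_mono) auto
  then show ?thesis
    using prob_net_le_sum[of k, where 'd = 'd] unfolding c_def[symmetric] sum_distrib_left by linarith
qed

section \<open>Tail of the coding radius\<close>

lemma sets_net: "{\<omega> \<in> space label_space. net (marks \<omega>) m 0} \<in> sets label_space"
proof (rule sets_label_space_marks[where u = 0 and r = "net_range m" and k = m])
  fix x y :: "'a vertex \<Rightarrow> real"
  assume "\<And>j v. j \<le> m \<Longrightarrow> nrm (v - 0) \<le> net_range m \<Longrightarrow> marks x j v = marks y j v"
    and xy: "x \<in> {\<omega> \<in> space label_space. net (marks \<omega>) m 0}" "y \<in> space label_space"
  then have "looks_like m (net_range m) 0 (marks x) (marks y)" by (auto simp: looks_like_def)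
  from net_looks_like[OF this, of 0] xy
  show "y \<in> {\<omega> \<in> space label_space. net (marks \<omega>) m 0}" by simp
qed auto

lemma prob_exposed_le:
  "measure label_space {\<omega> \<in> space label_space. exposed (marks \<omega>) m (u :: 'd::finite vertex)}
    \<le> 3 ^ CARD('d) * measure label_space {\<omega> \<in> space label_space. net (marks \<omega>) m (0 :: 'd vertex)}"
proof -
  interpret prob_space "label_space :: ('d vertex \<Rightarrow> real) measure" by (rule prob_space_label_space)
  let ?N = "{\<omega> \<in> space label_space. net (marks \<omega>) m (0 :: 'd vertex)}"
  let ?T = "\<lambda>w. {\<omega> \<in> space label_space. translate (u + w) \<omega> \<in> ?N}"
  let ?W = "{w :: 'd vertex. nrm w \<le> 1}"
  have "net (marks (translate a \<omega>)) m 0 \<longleftrightarrow> net (marks \<omega>) m (a + 0)" for a and \<omega> :: "'d vertex \<Rightarrow> real"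
    by (rule net_looks_like[OF looks_like_translate order_refl])
  then have "{\<omega> \<in> space label_space. exposed (marks \<omega>) m u} \<subseteq> (\<Union>w\<in>?W. ?T w)"
    by (auto simp: exposed_def translate_space)
  then have "prob {\<omega> \<in> space label_space. exposed (marks \<omega>) m u} \<le> prob (\<Union>w\<in>?W. ?T w)"
    by (rule finite_measure_mono) (intro sets.finite_UN finite_ball sets_translate sets_net)
  also have "\<dots> \<le> (\<Sum>w\<in>?W. prob (?T w))"
    by (intro measure_UNION_le finite_ball sets_translate sets_net)
  also have "\<dots> = real (card ?W) * prob ?N"
    by (simp only: measure_translate[OF sets_net] sum_constant)
  also have "\<dots> \<le> real (3 ^ CARD('d)) * prob ?N"
    using card_ball_le[of 1, where 'd = 'd] by (intro mult_right_mono of_nat_mono) auto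
  finally show ?thesis by simp
qed

text \<open>With \<open>N\<close> the size of the ball, isolation has probability at most
  \<open>exp (- q * N)\<close>. The mean \<open>q * N\<close> is at least
  \<open>2 ^ (d * m) / d ^ d\<close> and so outgrows the quadratic exponent of
  \<open>q ^ 2\<close>.\<close>

lemma isolation_le: "\<forall>\<^sub>F m in sequentially. isolation TYPE('d::finite) m \<le> intensity CARD('d) m ^ 2"
proof -
  define d where "d = CARD('d)"
  have d: "0 < d" by (simp add: d_def)
  define K where "K = 2 * real d * real d ^ d"
  have K: "0 < K" using d by (simp add: K_def)
  have "(\<lambda>m. real m * real m / 2 ^ m) \<longlonglongrightarrow> 0" by real_asymp
  then have "\<forall>\<^sub>F m in sequentially. real m * real m / 2 ^ m < 1 / K"
    using K by (intro order_tendstoD(2)) auto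
  then show ?thesis
  proof eventually_elim
    case (elim m)
    let ?q = "intensity d m" and ?c = "spacing m"
    let ?N = "card {v :: 'd vertex. nrm v \<le> ?c}"
    have "real ?c < real d * real (?c div d + 1)"
      using dividend_less_times_div[OF d, of ?c] by (simp flip: of_nat_mult of_nat_add of_nat_less_iff add: algebra_simps)
    then have "real ?c / real d \<le> real (?c div d + 1)" using d by (simp add: divide_le_eq mult.commute)
    then have "(real ?c / real d) ^ d \<le> real ((?c div d + 1) ^ d)"
      unfolding of_nat_power by (intro power_mono) auto
    also have "\<dots> \<le> real ?N"
      using card_ball_ge[of ?c, where 'd = 'd] unfolding d_def by (rule of_nat_mono)
    finally have N: "(real ?c / real d) ^ d \<le> real ?N" .
    have mm: "m \<le> m * m" by (cases m) auto
    have exps: "d * (m * m - m) + d * m = m * m * d"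
      using mm by (simp add: diff_mult_distrib2 mult_ac)
    have qc: "?q * real ?c ^ d = 2 ^ (d * m)"
    proof -
      have "real ?c ^ d = 2 ^ (d * (m * m - m) + d * m)"
        unfolding exps spacing_def by (simp add: power_mult)
      then show ?thesis by (simp add: intensity_def power_add power_one_over)
    qed
    have "2 * real d * (real m * real m) * real d ^ d \<le> 2 ^ m"
      using elim K by (simp add: K_def field_simps)
    also have "\<dots> \<le> 2 ^ (d * m)" using d by (intro power_increasing) auto
    also have "\<dots> \<le> ?q * real ?N * real d ^ d"
      using mult_left_mono[OF N less_imp_le[OF intensity_pos[of d m]]] d qc
      by (simp add: power_divide field_simps)
    finally have "2 * real d * (real m * real m) \<le> ?q * real ?N" using d by simp
    moreover have "2 * real d * (real m * real m) \<ge> real (d * (m * m - m) * 2) * ln 2"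
    proof -
      have "real (d * (m * m - m) * 2) * ln 2 \<le> real (d * (m * m - m) * 2) * 1"
        using ln_2_less_1 by (intro mult_left_mono of_nat_0_le_iff) simp
      also have "\<dots> \<le> real (d * (m * m) * 2)" by (simp only: mult_1_right of_nat_le_iff) simp
      finally show ?thesis by (simp add: mult_ac)
    qed
    ultimately have e: "real (d * (m * m - m) * 2) * ln 2 \<le> ?q * real ?N" by linarith
    have "isolation TYPE('d) m = (1 - ?q) ^ ?N" by (simp add: isolation_def d_def)
    also have "\<dots> \<le> exp (- ?q) ^ ?N"
      using exp_ge_add_one_self[of "- ?q"] intensity_le_1[of d m] by (intro power_mono) auto
    also have "\<dots> = exp (- (?q * real ?N))" by (simp add: exp_of_nat_mult[symmetric] mult.commute)
    also have "\<dots> \<le> exp (- (real (d * (m * m - m) * 2) * ln 2))" using e by simp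
    also have "\<dots> = exp (real (d * (m * m - m) * 2) * ln (1 / 2))" by (simp add: ln_div)
    also have "\<dots> = (1 / 2) ^ (d * (m * m - m) * 2)" by (subst exp_of_nat_mult) simp
    also have "\<dots> = ?q ^ 2" by (simp only: intensity_def power_mult)
    finally show ?case by (simp add: d_def)
  qed
qed

text \<open>The second factor is \<open>spacing m\<close> to the power \<open>-(d - 1)\<close>; the
  first one collects all factors \<open>2 ^ O(m)\<close>.\<close>

definition decay :: "nat \<Rightarrow> nat \<Rightarrow> real" where
  "decay d m = 2 ^ ((7 * d + 6) * m) * (1 / 2) ^ ((d - 1) * (m * m))"

lemma prob_exposed_le_decay:
  "\<forall>\<^sub>F m in sequentially. \<forall>u :: 'd::finite vertex.
    measure label_space {\<omega> \<in> space label_space. exposed (marks \<omega>) m u} \<le> decay CARD('d) m"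
  using isolation_le[where 'd = 'd] eventually_gt_at_top[of 0]
proof eventually_elim
  case (elim m)
  then obtain k where k: "m = Suc k" by (cases m) auto
  define d where "d = CARD('d)"
  have d: "0 < d" by (simp add: d_def)
  define q c where "q = intensity d m" and "c = spacing m"
  \<comment> \<open>\<open>X\<close> is the volume scale \<open>c ^ d\<close> and
    \<open>q = Y / X\<close>. The bracket in \<open>prob_net_le\<close> is then of order
    \<open>Y ^ 2 / X\<close>, and multiplication by the link length leaves
    \<open>c / X\<close>.\<close>
  define X Y :: real where "X = 2 ^ (m * m * d)" and "Y = 2 ^ (d * m)"
  have X: "0 < X" and Y: "1 \<le> Y" by (simp_all add: X_def Y_def)
  have cdX: "real c ^ d = X" by (simp add: c_def X_def spacing_def power_mult)
  have mm: "m \<le> m * m" by (cases m) auto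
  have qX: "q = Y / X"
  proof -
    have "d * (m * m - m) + d * m = m * m * d"
      using mm by (simp add: diff_mult_distrib2 mult_ac)
    then have "X = 2 ^ (d * (m * m - m)) * Y" unfolding X_def Y_def by (simp flip: power_add)
    then show ?thesis using Y by (simp add: q_def intensity_def power_one_over)
  qed
  have c1: "1 \<le> c" by (simp add: c_def spacing_def)
  have "real ((6 * c + 1) ^ d) \<le> real ((7 * c) ^ d)"
    using c1 by (intro of_nat_mono power_mono) auto
  also have "\<dots> = 7 ^ d * X" by (simp add: power_mult_distrib cdX)
  finally have six: "real ((6 * c + 1) ^ d) \<le> 7 ^ d * X" .
  have "2 * q + real ((6 * c + 1) ^ d) * (3 * q ^ 2) \<le> 2 * q + 7 ^ d * X * (3 * q ^ 2)"
    using six by (intro add_left_mono mult_right_mono) auto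
  also have "\<dots> = (2 * Y + 3 * 7 ^ d * Y ^ 2) / X"
    using X by (simp add: qX field_simps power2_eq_square)
  also have "\<dots> \<le> (5 * 7 ^ d * Y ^ 2) / X"
  proof (rule divide_right_mono)
    have "1 * Y \<le> 7 ^ d * Y ^ 2"
      using Y by (intro mult_mono self_le_power) auto
    then show "2 * Y + 3 * 7 ^ d * Y ^ 2 \<le> 5 * 7 ^ d * Y ^ 2"
      unfolding mult.assoc by linarith
  qed (use X in simp)
  finally have A: "2 * q + real ((6 * c + 1) ^ d) * (3 * q ^ 2) \<le> 5 * 7 ^ d * Y ^ 2 / X" .
  have "len m + 1 \<le> 2 * len m" using spacing_le_len[of m] spacing_pos[of m] by linarith
  then have "real (len m + 1) \<le> real (2 * len m)" by (rule of_nat_mono)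
  also have "\<dots> = 2 * 3 ^ m * real c" by (simp add: len_def c_def)
  finally have L: "real (len m + 1) \<le> 2 * 3 ^ m * real c" .
  have N: "measure label_space {\<omega> \<in> space label_space. net (marks \<omega>) m (0 :: 'd vertex)}
      \<le> real (len m + 1) * (2 * q + real ((6 * c + 1) ^ d) * (3 * q ^ 2))"
    using prob_net_le[of k, where 'd = 'd] elim(1) unfolding q_def c_def d_def k by simp
  also have "\<dots> \<le> (2 * 3 ^ m * real c) * (5 * 7 ^ d * Y ^ 2 / X)"
    using A L qX X Y by (intro mult_mono) auto
  finally have B: "measure label_space {\<omega> \<in> space label_space. net (marks \<omega>) m (0 :: 'd vertex)}
      \<le> (2 * 3 ^ m * real c) * (5 * 7 ^ d * Y ^ 2 / X)" .
  have cX: "real c / X = (1 / 2) ^ ((d - 1) * (m * m))"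
  proof -
    have "m * m * d = m * m + (d - 1) * (m * m)" using d by (cases d) auto
    then show ?thesis by (simp add: c_def X_def spacing_def power_add power_one_over)
  qed
  have "3 ^ d * ((2 * 3 ^ m * real c) * (5 * 7 ^ d * Y ^ 2 / X)) =
      (10 * (3 * 7) ^ d * 3 ^ m * Y ^ 2) * (1 / 2) ^ ((d - 1) * (m * m))"
    unfolding cX[symmetric] power_mult_distrib by (simp add: mult_ac)
  \<comment> \<open>All constants are rounded up to powers of 2. As \<open>m \<ge> 1\<close>, the
    exponents add up to at most \<open>(7 * d + 6) * m\<close>, which is the constant in
    \<open>decay\<close>.\<close>
  also have "\<dots> \<le> (2 ^ 4 * 2 ^ (5 * d) * 2 ^ (2 * m) * 2 ^ (d * m * 2)) * (1 / 2) ^ ((d - 1) * (m * m))"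
  proof (intro mult_right_mono mult_mono)
    show "(3 * 7) ^ d \<le> (2 :: real) ^ (5 * d)" unfolding power_mult by (intro power_mono) auto
    show "3 ^ m \<le> (2 :: real) ^ (2 * m)" unfolding power_mult by (intro power_mono) auto
    show "Y ^ 2 \<le> 2 ^ (d * m * 2)" unfolding Y_def by (simp only: power_mult)
  qed auto
  also have "2 ^ 4 * 2 ^ (5 * d) * 2 ^ (2 * m) * 2 ^ (d * m * 2) = (2 :: real) ^ (4 + 5 * d + 2 * m + d * m * 2)"
    by (simp only: power_add)
  also have "\<dots> \<le> 2 ^ ((7 * d + 6) * m)"
    by (rule power_increasing) (simp_all add: k algebra_simps)
  finally have C: "3 ^ d * ((2 * 3 ^ m * real c) * (5 * 7 ^ d * Y ^ 2 / X)) \<le> decay d m"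
    by (simp add: decay_def mult_right_mono)
  show ?case
  proof
    fix u :: "'d vertex"
    show "measure label_space {\<omega> \<in> space label_space. exposed (marks \<omega>) m u} \<le> decay CARD('d) m"
      using prob_exposed_le[of m u] mult_left_mono[OF B, of "3 ^ d"] C unfolding d_def by simp
  qed
qed

lemma decay_le:
  assumes "2 \<le> d" "7 * d + 7 \<le> m"
  shows "decay d m \<le> (1 / 2) ^ m"
proof -
  have "(7 * d + 6) * m + m = (7 * d + 7) * m" by (simp add: algebra_simps)
  also have "\<dots> \<le> m * m" using assms(2) by (rule mult_le_mono1)
  also have "\<dots> \<le> (d - 1) * (m * m)"
  proof -
    have "1 \<le> d - 1" using assms(1) by linarith
    from mult_le_mono1[OF this, of "m * m"] show ?thesis by (simp only: mult_1)
  qed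
  finally have "(1 / 2 :: real) ^ ((d - 1) * (m * m)) \<le> (1 / 2) ^ ((7 * d + 6) * m + m)"
    by (intro power_decreasing) auto
  then have "decay d m \<le> 2 ^ ((7 * d + 6) * m) * (1 / 2) ^ ((7 * d + 6) * m + m)"
    unfolding decay_def by (intro mult_left_mono) auto
  also have "\<dots> = (1 / 2) ^ m" by (simp add: power_add power_one_over)
  finally show ?thesis .
qed

text \<open>Being exposed at all levels is contained in being exposed at level \<open>m\<close>, for
  each \<open>m\<close>, and by \<open>decay_le\<close> the latter probabilities tend to 0.\<close>

lemma AE_not_exposed:
  assumes "2 \<le> CARD('d::finite)"
  shows "AE \<omega> in label_space. \<forall>u :: 'd vertex. \<exists>m. \<not> exposed (marks \<omega>) m u"
  unfolding AE_all_countable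
proof
  fix u :: "'d vertex"
  interpret prob_space "label_space :: ('d vertex \<Rightarrow> real) measure" by (rule prob_space_label_space)
  let ?E = "\<lambda>m. {\<omega> \<in> space label_space. exposed (marks \<omega>) m u}"
  have "\<forall>\<^sub>F m in sequentially. prob (\<Inter>m. ?E m) \<le> (1 / 2) ^ m"
    using prob_exposed_le_decay[where 'd = 'd] eventually_ge_at_top[of "7 * CARD('d) + 7"]
  proof eventually_elim
    case (elim m)
    have "prob (\<Inter>m. ?E m) \<le> prob (?E m)"
      by (rule finite_measure_mono) (auto intro: sets_exposed)
    also have "\<dots> \<le> decay CARD('d) m" using elim(1) by blast
    also have "\<dots> \<le> (1 / 2) ^ m" by (rule decay_le[OF assms elim(2)])
    finally show ?case .
  qed
  moreover have "(\<lambda>m. (1 / 2 :: real) ^ m) \<longlonglongrightarrow> 0" by (rule LIMSEQ_power_zero) simp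
  ultimately have "prob (\<Inter>m. ?E m) \<le> 0"
    by (intro tendsto_le[OF _ _ tendsto_const]) auto
  then have "emeasure label_space (\<Inter>m. ?E m) = 0" by (simp add: emeasure_eq_measure measure_le_0_iff)
  moreover have "(\<Inter>m. ?E m) \<in> events" by (intro sets.countable_INT) (auto intro: sets_exposed)
  ultimately show "AE \<omega> in label_space. \<exists>m. \<not> exposed (marks \<omega>) m u"
    by (intro AE_I[of _ _ "\<Inter>m. ?E m"]) auto
qed

lemma solves_halting:
  assumes "2 \<le> CARD('d::finite)"
  shows "solves (halting :: 'd nbhd set) outcome PM_valid"
  unfolding solves_def
  using AE_not_exposed[OF assms] AE_space
proof eventually_elim
  case (elim \<omega>)
  have "coding_radius halting \<omega> u \<noteq> \<infinity>" for u
  proof -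
    obtain m where "\<not> exposed (marks \<omega>) m u" using elim(1) by blast
    from coding_radius_le[OF elim(2) this] show ?thesis
      by (cases "coding_radius halting \<omega> u") auto
  qed
  moreover have "PM_valid (run halting outcome \<omega>)"
    by (rule PM_valid_run_halting[OF elim(2)]) (use elim(1) in blast)
  ultimately show ?case by blast
qed

text \<open>Here \<open>l\<close> stands for \<open>log 2 (1 / \<epsilon>)\<close>, and
  \<open>x\<close> solves \<open>(d - 1) * x\<^sup>2 = l\<close>, so that a level near
  \<open>x\<close> balances the decay against \<open>\<epsilon>\<close>. The additional
  \<open>7 * d + 6\<close> levels pay for the first factor of \<open>decay\<close>.\<close>

lemma level_choice:
  fixes d m :: nat and l x :: real
  assumes "2 \<le> d" "1 \<le> l" and x: "x = sqrt (l / real (d - 1))" and m: "m = nat \<lceil>x\<rceil> + (7 * d + 6)"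
  shows "decay d m \<le> 2 powr (- l)"
    and "real (radius m) \<le> 2 powr (l / real (d - 1)) * 2 powr (real ((7 * d + 6)\<^sup>2 + 8 * (7 * d + 6) + 18) * sqrt l)"
proof -
  define \<kappa> where "\<kappa> = 7 * d + 6"
  define D where "D = real (d - 1)"
  have D: "1 \<le> D" using assms(1) by (simp add: D_def)
  have x0: "0 \<le> x" and xx: "x * x = l / D" using assms(2) D by (simp_all add: x D_def)
  have ml: "x + real \<kappa> \<le> real m" and mu: "real m \<le> x + real \<kappa> + 1"
    using x0 unfolding m \<kappa>_def[symmetric] by linarith+
  have "D * (x * x) \<le> D * (real m * (real m - real \<kappa>))"
    using ml x0 D by (intro mult_left_mono mult_mono) auto
  also have "\<dots> = D * (real m * real m) - D * (real \<kappa> * real m)" by (simp add: algebra_simps)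
  also have "\<dots> \<le> D * (real m * real m) - real \<kappa> * real m"
    using mult_right_mono[OF D, of "real \<kappa> * real m"] by simp
  finally have l: "l \<le> D * (real m * real m) - real \<kappa> * real m" using xx D by simp
  have "decay d m = 2 powr (real \<kappa> * real m) * 2 powr (- (D * (real m * real m)))"
    by (simp add: decay_def \<kappa>_def[symmetric] D_def powr_realpow[symmetric] powr_minus_divide power_one_over)
  also have "\<dots> = 2 powr (real \<kappa> * real m - D * (real m * real m))" by (simp flip: powr_add)
  also have "\<dots> \<le> 2 powr (- l)" using l by simp
  finally show "decay d m \<le> 2 powr (- l)" .
  have s: "1 \<le> sqrt l" using assms(2) by simp
  have xs: "x \<le> sqrt l"
    unfolding x using D assms(2) by (intro real_sqrt_le_mono) (simp add: D_def[symmetric] divide_le_eq)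
  have "real (radius m) \<le> 2 ^ 4 * 2 ^ (2 * Suc m) * 2 ^ (Suc m * Suc m)"
  proof -
    have "(3 :: real) ^ Suc m \<le> 2 ^ (2 * Suc m)" unfolding power_mult by (intro power_mono) auto
    then have "15 * 3 ^ Suc m * 2 ^ (Suc m * Suc m) \<le> (2 :: real) ^ 4 * 2 ^ (2 * Suc m) * 2 ^ (Suc m * Suc m)"
      by (intro mult_right_mono mult_mono) auto
    moreover have "real (radius m) = 15 * 3 ^ Suc m * 2 ^ (Suc m * Suc m)"
      by (simp only: radius_def len_def spacing_def of_nat_mult of_nat_power of_nat_numeral mult.assoc)
    ultimately show ?thesis by (simp only:)
  qed
  also have "\<dots> = 2 powr real (4 + 2 * Suc m + Suc m * Suc m)"
    by (simp only: powr_realpow zero_less_numeral power_add)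
  \<comment> \<open>The term \<open>x * x\<close> yields the root of \<open>1 / \<epsilon>\<close>.
    What remains is linear in \<open>x\<close> or constant and is bounded by a multiple of
    \<open>sqrt l\<close>, using \<open>x \<le> sqrt l\<close> and \<open>1 \<le> sqrt l\<close>;
    the coefficients \<open>2 * \<kappa> + 6\<close> and
    \<open>\<kappa>\<^sup>2 + 6 * \<kappa> + 12\<close> add up to the constant.\<close>
  also have "\<dots> \<le> 2 powr (x * x + real (\<kappa>\<^sup>2 + 8 * \<kappa> + 18) * sqrt l)"
  proof (rule powr_mono)
    let ?n = "real m + 1" and ?K = "real \<kappa>"
    have n: "0 \<le> ?n" "?n \<le> x + ?K + 2" using mu by auto
    have nn: "?n * ?n \<le> (x + ?K + 2) * (x + ?K + 2)" using n by (intro mult_mono) auto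
    have "4 + 2 * a + b \<le> 4 + 2 * a' + b'" if "a \<le> a'" "b \<le> b'" for a a' b b' :: real
      using that by simp
    from this[OF n(2) nn]
    have "4 + 2 * ?n + ?n * ?n \<le> 4 + 2 * (x + ?K + 2) + (x + ?K + 2) * (x + ?K + 2)" .
    also have "\<dots> = x * x + (2 * ?K + 6) * x + (?K\<^sup>2 + 6 * ?K + 12)"
      by (simp add: algebra_simps power2_eq_square)
    also have "\<dots> \<le> x * x + (2 * ?K + 6) * sqrt l + (?K\<^sup>2 + 6 * ?K + 12) * sqrt l"
    proof (intro add_mono[OF add_mono[OF order_refl]])
      show "(2 * ?K + 6) * x \<le> (2 * ?K + 6) * sqrt l" by (intro mult_left_mono xs) simp
      have "0 \<le> ?K\<^sup>2 + 6 * ?K + 12" by simp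
      from mult_left_mono[OF s this] show "?K\<^sup>2 + 6 * ?K + 12 \<le> (?K\<^sup>2 + 6 * ?K + 12) * sqrt l"
        by simp
    qed
    finally show "real (4 + 2 * Suc m + Suc m * Suc m) \<le> x * x + real (\<kappa>\<^sup>2 + 8 * \<kappa> + 18) * sqrt l"
      by (simp add: algebra_simps)
  qed simp
  finally show "real (radius m) \<le> 2 powr (l / real (d - 1)) * 2 powr (real ((7 * d + 6)\<^sup>2 + 8 * (7 * d + 6) + 18) * sqrt l)"
    unfolding xx powr_add D_def \<kappa>_def .
qed

lemma has_uniform_complexity_halting:
  fixes d :: nat
  assumes d2: "2 \<le> CARD('d::finite)"
  defines "d \<equiv> CARD('d)"
  shows "has_uniform_complexity (halting :: 'd nbhd set)
    (\<lambda>\<epsilon>. root (d - 1) (1 / \<epsilon>) * 2 powr (real ((7 * d + 6)\<^sup>2 + 8 * (7 * d + 6) + 18) * sqrt (log 2 (1 / \<epsilon>))))"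
proof -
  interpret prob_space "label_space :: ('d vertex \<Rightarrow> real) measure" by (rule prob_space_label_space)
  define D where "D = real (d - 1)"
  have D: "1 \<le> D" using d2 by (simp add: D_def d_def)
  define m where "m \<epsilon> = nat \<lceil>sqrt (log 2 (1 / \<epsilon>) / D)\<rceil> + (7 * d + 6)" for \<epsilon>
  have "filterlim (\<lambda>\<epsilon>. sqrt (log 2 (1 / \<epsilon>) / D)) at_top (at_right 0)"
    using D by real_asymp
  then have "\<forall>\<^sub>F \<epsilon> in at_right 0. Z \<le> m \<epsilon>" for Z
  proof -
    have "Z \<le> m \<epsilon>" if "real Z \<le> sqrt (log 2 (1 / \<epsilon>) / D)" for \<epsilon>
      using that unfolding m_def by linarith
    then show ?thesis
      using \<open>filterlim (\<lambda>\<epsilon>. sqrt (log 2 (1 / \<epsilon>) / D)) at_top (at_right 0)\<close>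
      unfolding filterlim_at_top by (blast intro: eventually_mono)
  qed
  \<comment> \<open>The tail bound holds only for large levels, so the chosen level has to tend to
    infinity as \<open>\<epsilon>\<close> tends to 0.\<close>
  then have "filterlim m sequentially (at_right 0)" by (simp add: filterlim_at_top)
  then have "\<forall>\<^sub>F \<epsilon> in at_right 0. \<forall>u :: 'd vertex. prob {\<omega> \<in> space label_space. exposed (marks \<omega>) (m \<epsilon>) u} \<le> decay d (m \<epsilon>)"
    using prob_exposed_le_decay[where 'd = 'd] unfolding d_def by (rule eventually_compose_filterlim[rotated])
  moreover have "\<forall>\<^sub>F \<epsilon> in at_right 0. 1 \<le> log 2 (1 / \<epsilon> :: real)" by real_asymp
  moreover have "\<forall>\<^sub>F \<epsilon> in at_right (0 :: real). 0 < \<epsilon>" by (rule eventually_at_right_less)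
  ultimately show ?thesis
    unfolding has_uniform_complexity_def
  proof eventually_elim
    case (elim \<epsilon>)
    define l where "l = log 2 (1 / \<epsilon>)"
    have "d \<ge> 2" using d2 by (simp add: d_def)
    note choice = level_choice[OF this elim(2)[folded l_def] refl, folded D_def, OF m_def[of \<epsilon>, folded l_def]]
    have \<epsilon>: "2 powr l = 1 / \<epsilon>" using elim(3) by (simp add: l_def)
    have "root (d - 1) (1 / \<epsilon>) = (1 / \<epsilon>) powr (1 / D)"
      using elim(3) D unfolding D_def by (intro root_powr_inverse) auto
    also have "\<dots> = 2 powr (l / D)" by (simp add: \<epsilon>[symmetric] powr_powr)
    finally have root: "root (d - 1) (1 / \<epsilon>) = 2 powr (l / D)" .
    let ?t = "root (d - 1) (1 / \<epsilon>) * 2 powr (real ((7 * d + 6)\<^sup>2 + 8 * (7 * d + 6) + 18) * sqrt (log 2 (1 / \<epsilon>)))"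
    have t: "real (radius (m \<epsilon>)) \<le> ?t" using choice(2) unfolding root l_def .
    show ?case
    proof
      fix u :: "'d vertex"
      have "{\<omega> \<in> space label_space. ereal_of_enat (coding_radius halting \<omega> u) > ereal ?t}
          \<subseteq> {\<omega> \<in> space label_space. exposed (marks \<omega>) (m \<epsilon>) u}"
      proof (clarify, rule ccontr)
        fix \<omega> assume \<omega>: "\<omega> \<in> space label_space" "ereal ?t < ereal_of_enat (coding_radius halting \<omega> u)"
          "\<not> exposed (marks \<omega>) (m \<epsilon>) u"
        have "ereal_of_enat (coding_radius halting \<omega> u) \<le> ereal_of_enat (enat (radius (m \<epsilon>)))"
          using coding_radius_le[OF \<omega>(1,3)] by (simp only: ereal_of_enat_le_iff)
        also have "\<dots> \<le> ereal ?t" using t by simp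
        finally show False using \<omega>(2) by simp
      qed
      then have "prob {\<omega> \<in> space label_space. ereal_of_enat (coding_radius halting \<omega> u) > ereal ?t}
          \<le> prob {\<omega> \<in> space label_space. exposed (marks \<omega>) (m \<epsilon>) u}"
        by (rule finite_measure_mono) (rule sets_exposed)
      also have "\<dots> \<le> decay d (m \<epsilon>)" using elim(1) by blast
      also have "\<dots> \<le> 2 powr (- l)" by (rule choice(1))
      also have "\<dots> = \<epsilon>" using \<epsilon> elim(3) by (simp add: powr_minus_divide)
      finally show "prob {\<omega> \<in> space label_space. ereal_of_enat (coding_radius halting \<omega> u) > ereal ?t} \<le> \<epsilon>" .
    qed
  qed
qed

theorem theorem6p2:
  assumes "CARD('d::finite) \<ge> 2"
  shows "\<exists>(C :: 'd nbhd set) (f :: 'd nbhd \<Rightarrow> 'd vertex) (h :: real \<Rightarrow> real).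
           uniform_local_algorithm PM_labels C f \<and>
           solves C f PM_valid \<and>
           h \<in> O[at_right 0](\<lambda>\<epsilon>. sqrt (log 2 (1 / \<epsilon>))) \<and>
           has_uniform_complexity C (\<lambda>\<epsilon>. root (CARD('d) - 1) (1 / \<epsilon>) * 2 powr h \<epsilon>)"
proof (intro exI conjI)
  show "uniform_local_algorithm PM_labels (halting :: 'd nbhd set) outcome"
    by (rule uniform_local_algorithm_halting)
  show "solves (halting :: 'd nbhd set) outcome PM_valid" by (rule solves_halting[OF assms])
  show "has_uniform_complexity (halting :: 'd nbhd set) (\<lambda>\<epsilon>. root (CARD('d) - 1) (1 / \<epsilon>) *
      2 powr (real ((7 * CARD('d) + 6)\<^sup>2 + 8 * (7 * CARD('d) + 6) + 18) * sqrt (log 2 (1 / \<epsilon>))))"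
    by (rule has_uniform_complexity_halting[OF assms])
  show "(\<lambda>\<epsilon>. real ((7 * CARD('d) + 6)\<^sup>2 + 8 * (7 * CARD('d) + 6) + 18) * sqrt (log 2 (1 / \<epsilon>)))
      \<in> O[at_right 0](\<lambda>\<epsilon>. sqrt (log 2 (1 / \<epsilon>)))"
    by (simp del: of_nat_add of_nat_mult of_nat_power)
qed

end
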